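(* Let $X$ and $Y$ be perfectly normal Hausdorff spaces and $\mu\in\mathcal{P}_r(X)$, $\nu\in\mathcal{P}_r(Y)$ Radon probability measures. Then $\Gamma(\mu,\nu)=\Pi(\mu,\nu)$, in the sense that for every $\gamma\in\Gamma(\mu,\nu)$ the functional $f\mapsto\int_{X\times Y}f\,d\gamma$ on $C_b(X\times Y)$ is given by integration against a Radon probability measure on $X\times Y$ belonging to $\Pi(\mu,\nu)$, and conversely every element of $\Pi(\mu,\nu)$ (restricted to $\mathcal{U}(X\times Y)$) belongs to $\Gamma(\mu,\nu)$. Consequently the problems $(\mathbf{OP})$ and $(\mathbf{KP})$ coincide, and if $c\in lsc_{bi}(X\times Y)$ satisfies $v_{\min}(\mathbf{KP})<+\infty$, then $(\mathbf{KP})$ has a solution.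
   Context: $C_b(Z)$: real-valued bounded continuous functions on $Z$. $\mathcal{U}(Z)$: algebra generated by zero-sets. $\mathcal{M}^1(Z)$: finitely additive $\gamma:\mathcal{U}(Z)\to[0,\infty)$, $\gamma(Z)=1$, regular (for every $A\in\mathcal{U}(Z)$, $\varepsilon>0$ there is a zero-set $F\subseteq A$ with $\gamma(A\setminus F)<\varepsilon$). $lsc_{bi}(Z)$: proper bounded-below lower semicontinuous $g:Z\to\mathbb{R}\cup\{+\infty\}$, with $\int g\,d\gamma:=\sup\{\int fd\gamma: f\in C_b(Z),f\le g\}$. A Radon measure is a Borel measure $\mu$ such that for every Borel $B$ and $\varepsilon>0$ there is a compact $K\subseteq B$ with $|\mu|(B\setminus K)<\varepsilon$; $\mathcal{P}_r$ denotes Radon probability measures. $(\phi\oplus\psi)(x,y):=\phi(x)+\psi(y)$. $\Gamma(\mu,\nu):=\{\gamma\in\mathcal{M}^1(X\times Y):\int\phi\oplus\psi\,d\gamma=\int\phi\,d\mu+\int\psi\,d\nu\ \forall\phi\in C_b(X),\psi\in C_b(Y)\}$, $v_{\min}(\mathbf{OP}):=\inf\{\int c\,d\gamma:\gamma\in\Gamma(\mu,\nu)\}$. $\Pi(\mu,\nu):=\{\gamma\in\mathcal{P}_r(X\times Y):(\pi_X)_\#\gamma=\mu,(\pi_Y)_\#\gamma=\nu\}$ (Radon probability measures on $X\times Y$ with marginals $\mu,\nu$), and $v_{\min}(\mathbf{KP}):=\inf\{\int c\,d\gamma:\gamma\in\Pi(\mu,\nu)\}$. *)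

theory Defs
  imports "HOL-Analysis.Analysis" "HOL-Probability.Probability"
begin

text \<open>Perfectly normal: normal, and every closed set is a G-delta set.
  Hausdorffness is imposed through the type class t2_space.\<close>
definition perfectly_normal :: "'a topology \<Rightarrow> bool" where
  "perfectly_normal X \<longleftrightarrow> normal_space X \<and>
     (\<forall>F. closedin X F \<longrightarrow> (\<exists>U :: nat \<Rightarrow> 'a set. (\<forall>n. openin X (U n)) \<and> F = \<Inter>(range U)))"

definition Cb :: "('a::topological_space \<Rightarrow> real) set" where
  "Cb = {f. continuous_on UNIV f \<and> bounded (range f)}"

definition zero_sets :: "'a::topological_space set set" where
  "zero_sets = {Z. \<exists>f::'a \<Rightarrow> real. continuous_on UNIV f \<and> Z = f -` {0}}"

definition zero_algebra :: "'a::topological_space set set" where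
  "zero_algebra = \<Inter>{A. algebra UNIV A \<and> zero_sets \<subseteq> A}"

definition fa_prob :: "('a::topological_space set \<Rightarrow> real) \<Rightarrow> bool" where
  "fa_prob \<gamma> \<longleftrightarrow>
     (\<forall>A\<in>zero_algebra. 0 \<le> \<gamma> A) \<and>
     (\<forall>A\<in>zero_algebra. \<forall>B\<in>zero_algebra. A \<inter> B = {} \<longrightarrow> \<gamma> (A \<union> B) = \<gamma> A + \<gamma> B) \<and>
     \<gamma> UNIV = 1 \<and>
     (\<forall>A\<in>zero_algebra. \<forall>e>0. \<exists>F\<in>zero_sets. F \<subseteq> A \<and> \<gamma> (A - F) < e)"

text \<open>Integral of a bounded function against a finitely additive measure on the
  zero-set algebra: supremum of lower sums over finite partitions into sets of the algebra
  (the standard Dunford--Schwartz integral for bounded continuous functions).\<close>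
definition fa_integral :: "('a::topological_space set \<Rightarrow> real) \<Rightarrow> ('a \<Rightarrow> real) \<Rightarrow> real" where
  "fa_integral \<gamma> f = Sup {(\<Sum>i<n. c i * \<gamma> (A i)) | (n::nat) A c.
      (\<forall>i<n. A i \<in> zero_algebra) \<and> (\<forall>i<n. \<forall>j<n. i \<noteq> j \<longrightarrow> A i \<inter> A j = {}) \<and>
      (\<Union>i<n. A i) = UNIV \<and> (\<forall>i<n. \<forall>x\<in>A i. c i \<le> f x)}"

definition lsc_bi :: "('a::topological_space \<Rightarrow> ereal) set" where
  "lsc_bi = {g. (\<forall>t. closed {x. g x \<le> t}) \<and> (\<exists>x. g x \<noteq> \<infinity>) \<and> (\<exists>b::real. \<forall>x. ereal b \<le> g x)}"

definition op_int :: "('a::topological_space set \<Rightarrow> real) \<Rightarrow> ('a \<Rightarrow> ereal) \<Rightarrow> ereal" where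
  "op_int \<gamma> g = Sup {ereal (fa_integral \<gamma> f) | f. f \<in> Cb \<and> (\<forall>x. ereal (f x) \<le> g x)}"

definition radon_prob :: "'a::topological_space measure \<Rightarrow> bool" where
  "radon_prob M \<longleftrightarrow> prob_space M \<and> sets M = sets borel \<and>
     (\<forall>B\<in>sets borel. \<forall>e>0. \<exists>K. compact K \<and> K \<subseteq> B \<and> measure M (B - K) < e)"

text \<open>Lebesgue integral of a bounded-below extended-real function (shifted by its infimum).\<close>
definition kp_int :: "'a::topological_space measure \<Rightarrow> ('a \<Rightarrow> ereal) \<Rightarrow> ereal" where
  "kp_int M g = (let b = real_of_ereal (Inf (range g)) in
      ereal b + enn2ereal (\<integral>\<^sup>+ x. e2ennreal (g x - ereal b) \<partial>M))"

definition Gamma :: "'a::topological_space measure \<Rightarrow> 'b::topological_space measure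
    \<Rightarrow> (('a \<times> 'b) set \<Rightarrow> real) set" where
  "Gamma \<mu> \<nu> = {\<gamma>. fa_prob \<gamma> \<and>
     (\<forall>\<phi>\<in>Cb. \<forall>\<psi>\<in>Cb. fa_integral \<gamma> (\<lambda>(x, y). \<phi> x + \<psi> y) =
        (\<integral>x. \<phi> x \<partial>\<mu>) + (\<integral>y. \<psi> y \<partial>\<nu>))}"

definition Pi_cpl :: "'a::topological_space measure \<Rightarrow> 'b::topological_space measure
    \<Rightarrow> ('a \<times> 'b) measure set" where
  "Pi_cpl \<mu> \<nu> = {\<gamma>. radon_prob \<gamma> \<and> distr \<gamma> borel fst = \<mu> \<and> distr \<gamma> borel snd = \<nu>}"

definition vmin_OP :: "'a::topological_space measure \<Rightarrow> 'b::topological_space measure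
    \<Rightarrow> ('a \<times> 'b \<Rightarrow> ereal) \<Rightarrow> ereal" where
  "vmin_OP \<mu> \<nu> c = Inf ((\<lambda>\<gamma>. op_int \<gamma> c) ` Gamma \<mu> \<nu>)"

definition vmin_KP :: "'a::topological_space measure \<Rightarrow> 'b::topological_space measure
    \<Rightarrow> ('a \<times> 'b \<Rightarrow> ereal) \<Rightarrow> ereal" where
  "vmin_KP \<mu> \<nu> c = Inf ((\<lambda>\<gamma>. kp_int \<gamma> c) ` Pi_cpl \<mu> \<nu>)"

end

theory Submission
  imports Defs
begin

text \<open>A positive linear functional \<open>L\<close> on \<open>Cb\<close> of a Tychonoff space is integration against a Radon
  probability as soon as it is tight: outer regularization of \<open>G \<mapsto> sup {L f | 0 \<le> f \<le> 1\<^sub>G}\<close> is a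
  Caratheodory outer measure, countable subadditivity on open sets being where tightness enters.
  For \<open>\<gamma> \<in> \<Gamma>(\<mu>, \<nu>)\<close> tightness is inherited from the Radon marginals. Since this only uses the
  functional, it also applies to cluster points of the functionals of couplings, which yields minimizers;
  lower semicontinuity of the cost integral holds because it is a supremum of integrals of \<open>f \<in> Cb\<close>.\<close>

subsection \<open>Finitely additive integrals\<close>

text \<open>A product of two normal spaces need not be normal, so Urysohn functions for arbitrary
  disjoint closed sets are not at hand on the product. Complete regularity is inherited, and it
  separates compact sets from disjoint closed ones; the covering and approximation arguments on the
  product are therefore run on compact sets. Normality is exploited on the factors, where it yields
  dominating functions with small integral and lets the integrals of continuous functions determine
  a Radon measure. A second obstacle is that \<open>fa_integral\<close> is a supremum of lower sums,
  for which only superadditivity is immediate. Linearity rests on slicing a bounded continuous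
  function along level sets, all of which belong to the zero-set algebra. The equality of the two
  optimal values follows because \<open>op_int\<close> and \<open>kp_int\<close> turn out to be the
  same supremum over continuous functions below the cost. Hence a finitely additive \<gamma> and its
  representing measure never have to be compared set by set; equal integrals on \<open>Cb\<close>
  suffice.\<close>

lemma CbI: "continuous_on UNIV f \<Longrightarrow> (\<And>x. \<bar>f x\<bar> \<le> B) \<Longrightarrow> f \<in> Cb"
  unfolding Cb_def by (auto simp: bounded_iff)

lemma Cb_continuous: "f \<in> Cb \<Longrightarrow> continuous_on UNIV f"
  unfolding Cb_def by auto

lemma Cb_bound: "f \<in> Cb \<Longrightarrow> \<exists>B>0. \<forall>x. \<bar>f x\<bar> \<le> B"
  unfolding Cb_def bounded_pos by auto

lemma Cb_const: "(\<lambda>_. a) \<in> Cb"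
  by (rule CbI[of _ "\<bar>a\<bar>"]) auto

lemma Cb_add:
  assumes "f \<in> Cb" "g \<in> Cb" shows "(\<lambda>x. f x + g x) \<in> Cb"
proof -
  obtain B where B: "\<forall>x. \<bar>f x\<bar> \<le> B" using Cb_bound[OF assms(1)] by auto
  obtain C where C: "\<forall>x. \<bar>g x\<bar> \<le> C" using Cb_bound[OF assms(2)] by auto
  show ?thesis
  proof (rule CbI)
    show "\<bar>f x + g x\<bar> \<le> B + C" for x
      using B[rule_format, of x] C[rule_format, of x] by linarith
  qed (intro continuous_on_add Cb_continuous assms)
qed

lemma Cb_mult:
  assumes "f \<in> Cb" "g \<in> Cb" shows "(\<lambda>x. f x * g x) \<in> Cb"
proof -
  obtain B where B: "B > 0" "\<forall>x. \<bar>f x\<bar> \<le> B" using Cb_bound[OF assms(1)] by auto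
  obtain C where C: "\<forall>x. \<bar>g x\<bar> \<le> C" using Cb_bound[OF assms(2)] by auto
  show ?thesis
  proof (rule CbI)
    show "\<bar>f x * g x\<bar> \<le> B * C" for x
      using B C by (auto simp: abs_mult intro!: mult_mono)
  qed (intro continuous_on_mult Cb_continuous assms)
qed

lemma Cb_cmult: "f \<in> Cb \<Longrightarrow> (\<lambda>x. a * f x) \<in> Cb"
  by (intro Cb_mult Cb_const)

lemma Cb_uminus: "f \<in> Cb \<Longrightarrow> (\<lambda>x. - f x) \<in> Cb"
  using Cb_cmult[of f "-1"] by simp

lemma Cb_diff: "f \<in> Cb \<Longrightarrow> g \<in> Cb \<Longrightarrow> (\<lambda>x. f x - g x) \<in> Cb"
  using Cb_add[OF _ Cb_uminus, of f g] by simp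

lemma Cb_abs:
  assumes "f \<in> Cb" shows "(\<lambda>x. \<bar>f x\<bar>) \<in> Cb"
proof -
  obtain B where "\<forall>x. \<bar>f x\<bar> \<le> B" using Cb_bound[OF assms(1)] by auto
  then show ?thesis
    by (intro CbI[of _ B] continuous_on_rabs Cb_continuous[OF assms]) auto
qed

lemma Cb_max: "f \<in> Cb \<Longrightarrow> g \<in> Cb \<Longrightarrow> (\<lambda>x. max (f x) (g x)) \<in> Cb"
proof -
  assume a: "f \<in> Cb" "g \<in> Cb"
  have eq: "(\<lambda>x. max (f x) (g x)) = (\<lambda>x. (1/2) * (f x + g x + \<bar>f x - g x\<bar>))"
    by (auto simp: fun_eq_iff max_def)
  show ?thesis
    unfolding eq by (intro Cb_cmult Cb_add Cb_abs Cb_diff a)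
qed

lemma Cb_min: "f \<in> Cb \<Longrightarrow> g \<in> Cb \<Longrightarrow> (\<lambda>x. min (f x) (g x)) \<in> Cb"
proof -
  assume a: "f \<in> Cb" "g \<in> Cb"
  have eq: "(\<lambda>x. min (f x) (g x)) = (\<lambda>x. - max (- f x) (- g x))"
    by (auto simp: fun_eq_iff max_def min_def)
  show ?thesis
    unfolding eq by (intro Cb_uminus Cb_max a)
qed

lemma Cb_sum: "(\<And>i. i \<in> I \<Longrightarrow> f i \<in> Cb) \<Longrightarrow> (\<lambda>x. \<Sum>i\<in>I. f i x) \<in> Cb"
  by (induction I rule: infinite_finite_induct) (auto simp: Cb_const intro: Cb_add)

lemma Cb_compose:
  assumes "f \<in> Cb" "continuous_on UNIV h" shows "(\<lambda>x. f (h x)) \<in> Cb"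
proof -
  obtain B where "\<forall>x. \<bar>f x\<bar> \<le> B" using Cb_bound[OF assms(1)] by auto
  then show ?thesis
    by (intro CbI[of _ B] continuous_on_compose2[OF Cb_continuous[OF assms(1)] assms(2)]) auto
qed

text \<open>Common abstraction of finitely additive integrals, Lebesgue integrals and their cluster
  points. Each clause is a closed condition on finitely many values of \<open>L\<close>, so it
  survives passing to a cluster point in the product topology.\<close>

definition mean_functional :: "(('a::topological_space \<Rightarrow> real) \<Rightarrow> real) \<Rightarrow> bool" where
  "mean_functional L \<longleftrightarrow>
     (\<forall>f\<in>Cb. \<forall>g\<in>Cb. L (\<lambda>z. f z + g z) = L f + L g) \<and>
     (\<forall>a. \<forall>f\<in>Cb. L (\<lambda>z. a * f z) = a * L f) \<and>
     (\<forall>f\<in>Cb. (\<forall>z. 0 \<le> f z) \<longrightarrow> 0 \<le> L f) \<and>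
     L (\<lambda>_. 1) = 1"

context
  fixes L :: "('a::topological_space \<Rightarrow> real) \<Rightarrow> real"
  assumes L: "mean_functional L"
begin

lemma mean_add: "f \<in> Cb \<Longrightarrow> g \<in> Cb \<Longrightarrow> L (\<lambda>z. f z + g z) = L f + L g"
  and mean_cmult: "f \<in> Cb \<Longrightarrow> L (\<lambda>z. a * f z) = a * L f"
  and mean_nonneg: "f \<in> Cb \<Longrightarrow> (\<And>z. 0 \<le> f z) \<Longrightarrow> 0 \<le> L f"
  and mean_one: "L (\<lambda>_. 1) = 1"
  using L unfolding mean_functional_def by auto

lemma mean_const: "L (\<lambda>_. a) = a"
  using mean_cmult[OF Cb_const[of 1], of a] mean_one by simp

lemma mean_diff: "f \<in> Cb \<Longrightarrow> g \<in> Cb \<Longrightarrow> L (\<lambda>z. f z - g z) = L f - L g"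
  using mean_add[of f "\<lambda>z. (-1) * g z"] mean_cmult[of g "-1"] by (simp add: Cb_uminus)

lemma mean_mono: "f \<in> Cb \<Longrightarrow> g \<in> Cb \<Longrightarrow> (\<And>z. f z \<le> g z) \<Longrightarrow> L f \<le> L g"
  using mean_nonneg[of "\<lambda>z. g z - f z"] mean_diff[of g f] by (simp add: Cb_diff)

lemma mean_sum: "finite I \<Longrightarrow> (\<And>i. i \<in> I \<Longrightarrow> f i \<in> Cb) \<Longrightarrow> L (\<lambda>x. \<Sum>i\<in>I. f i x) = (\<Sum>i\<in>I. L (f i))"
  by (induction I rule: finite_induct) (auto simp: mean_const mean_add Cb_sum)

end

section \<open>The zero-set algebra and lower sums over its finite partitions\<close>

lemma algebra_zero_algebra: "algebra UNIV (zero_algebra :: 'a::topological_space set set)"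
proof -
  have "algebra UNIV A" if "A \<in> {A. algebra UNIV A \<and> zero_sets \<subseteq> A}" for A :: "'a set set"
    using that by simp
  then show ?thesis
    unfolding zero_algebra_def algebra_iff_Un by auto
qed

lemma zero_sets_subset_zero_algebra: "zero_sets \<subseteq> zero_algebra"
  unfolding zero_algebra_def by auto

lemma zero_algebra_minimal: "algebra UNIV A \<Longrightarrow> zero_sets \<subseteq> A \<Longrightarrow> zero_algebra \<subseteq> A"
  unfolding zero_algebra_def by auto

interpretation zero_algebra: algebra UNIV "zero_algebra :: 'a::topological_space set set"
  by (rule algebra_zero_algebra)

lemma zero_sets_ge:
  fixes f :: "'a::topological_space \<Rightarrow> real"
  assumes "continuous_on UNIV f" shows "{z. a \<le> f z} \<in> zero_sets"
proof -
  have "continuous_on UNIV (\<lambda>z. max (a - f z) 0)"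
    by (intro continuous_intros assms)
  moreover have "{z. a \<le> f z} = (\<lambda>z. max (a - f z) 0) -` {0}"
    by (auto simp: max_def split: if_splits)
  ultimately show ?thesis unfolding zero_sets_def by blast
qed

text \<open>The index set is an arbitrary finite set, since common refinements are naturally indexed
  by pairs and level slices by integers.\<close>

definition zero_partition :: "'i set \<Rightarrow> ('i \<Rightarrow> 'a::topological_space set) \<Rightarrow> bool" where
  "zero_partition I A \<longleftrightarrow> finite I \<and> A ` I \<subseteq> zero_algebra \<and> disjoint_family_on A I \<and> (\<Union>i\<in>I. A i) = UNIV"

context
  fixes \<gamma> :: "'a::topological_space set \<Rightarrow> real"
  assumes \<gamma>: "fa_prob \<gamma>"
begin

lemma fa_nonneg: "A \<in> zero_algebra \<Longrightarrow> 0 \<le> \<gamma> A"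
  and fa_Un: "A \<in> zero_algebra \<Longrightarrow> B \<in> zero_algebra \<Longrightarrow> A \<inter> B = {} \<Longrightarrow> \<gamma> (A \<union> B) = \<gamma> A + \<gamma> B"
  and fa_UNIV: "\<gamma> UNIV = 1"
  using \<gamma> unfolding fa_prob_def by auto

lemma fa_empty: "\<gamma> {} = 0"
  using fa_Un[of "{}" "{}"] zero_algebra.empty_sets by auto

lemma fa_UN:
  assumes "finite I" "A ` I \<subseteq> zero_algebra" "disjoint_family_on A I"
  shows "\<gamma> (\<Union>i\<in>I. A i) = (\<Sum>i\<in>I. \<gamma> (A i))"
  using assms
proof (induction I rule: finite_induct)
  case (insert i I)
  have "\<gamma> (A i \<union> (\<Union>i\<in>I. A i)) = \<gamma> (A i) + \<gamma> (\<Union>i\<in>I. A i)"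
    using insert.prems insert.hyps
    by (intro fa_Un zero_algebra.finite_UN) (auto simp: disjoint_family_on_def)
  also have "\<gamma> (\<Union>i\<in>I. A i) = (\<Sum>i\<in>I. \<gamma> (A i))"
    using insert.prems by (intro insert.IH) (auto simp: disjoint_family_on_def)
  finally show ?case using insert.hyps by simp
qed (simp add: fa_empty)

lemma zero_partition_sum: "zero_partition I A \<Longrightarrow> (\<Sum>i\<in>I. \<gamma> (A i)) = 1"
  using fa_UN[of I A] fa_UNIV by (simp add: zero_partition_def)

lemma lower_sum_le_bound:
  assumes "zero_partition I A" "\<And>i x. i \<in> I \<Longrightarrow> x \<in> A i \<Longrightarrow> c i \<le> f x" "\<And>x. f x \<le> B"
  shows "(\<Sum>i\<in>I. c i * \<gamma> (A i)) \<le> B"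
proof -
  have "c i * \<gamma> (A i) \<le> B * \<gamma> (A i)" if "i \<in> I" for i
  \<comment> \<open>On an empty cell the coefficient is unconstrained and may exceed
    \<open>B\<close>, but such a cell has measure 0.\<close>
  proof (cases "A i = {}")
    case True then show ?thesis by (simp add: fa_empty)
  next
    case False
    then obtain x where "x \<in> A i" by auto
    then have "c i \<le> B" using assms(2)[OF that] assms(3) order_trans by blast
    then show ?thesis
      using assms(1) that by (intro mult_right_mono fa_nonneg) (auto simp: zero_partition_def)
  qed
  then have "(\<Sum>i\<in>I. c i * \<gamma> (A i)) \<le> (\<Sum>i\<in>I. B * \<gamma> (A i))"
    by (rule sum_mono)
  also have "\<dots> = B"
    using zero_partition_sum[OF assms(1)] by (simp flip: sum_distrib_left)
  finally show ?thesis .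
qed

lemma fa_integral_alt:
  "fa_integral \<gamma> f = Sup {(\<Sum>i<n. c i * \<gamma> (A i)) | (n::nat) A c.
      zero_partition {..<n} A \<and> (\<forall>i<n. \<forall>x\<in>A i. c i \<le> f x)}"
  unfolding fa_integral_def zero_partition_def disjoint_family_on_def
  by (rule arg_cong[where f = Sup], rule Collect_cong) (intro ex_cong1, auto)

text \<open>An enumeration of \<open>I\<close> brings the partition into the form required by the
  definition. The bound \<open>B\<close> makes the set of lower sums bounded above, without which
  the real \<open>Sup\<close> would say nothing.\<close>

lemma lower_sum_le_fa_integral:
  assumes P: "zero_partition I A" and c: "\<And>i x. i \<in> I \<Longrightarrow> x \<in> A i \<Longrightarrow> c i \<le> f x"
    and B: "\<And>x. f x \<le> B"
  shows "(\<Sum>i\<in>I. c i * \<gamma> (A i)) \<le> fa_integral \<gamma> f"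
proof -
  have "finite I" using P by (simp add: zero_partition_def)
  then obtain h where h: "bij_betw h {..<card I} I"
    using ex_bij_betw_nat_finite[of I] by (auto simp: atLeast0LessThan)
  have hI: "h ` {..<card I} = I" and inj: "inj_on h {..<card I}"
    using h by (auto simp: bij_betw_def)
  have AhI: "(\<lambda>i. A (h i)) ` {..<card I} = A ` I"
    unfolding image_image[of A h, symmetric] hI ..
  have P': "zero_partition {..<card I} (A \<circ> h)"
    unfolding zero_partition_def
  proof (intro conjI)
    have "A (h i) \<inter> A (h j) = {}" if "i < card I" "j < card I" "i \<noteq> j" for i j
    proof -
      have "h i \<in> I" "h j \<in> I" "h i \<noteq> h j"
        using that hI inj by (auto simp: inj_on_def)
      then show ?thesis using P by (simp add: zero_partition_def disjoint_family_on_def)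
    qed
    then show "disjoint_family_on (A \<circ> h) {..<card I}"
      by (simp add: disjoint_family_on_def)
  qed (use P in \<open>simp_all add: zero_partition_def AhI\<close>)
  have "(\<Sum>i\<in>I. c i * \<gamma> (A i)) = (\<Sum>i<card I. (c \<circ> h) i * \<gamma> ((A \<circ> h) i))"
    using sum.reindex_bij_betw[OF h, of "\<lambda>i. c i * \<gamma> (A i)"] by simp
  moreover have "\<forall>i<card I. \<forall>x\<in>(A \<circ> h) i. (c \<circ> h) i \<le> f x"
    using hI c by auto
  ultimately have "(\<Sum>i\<in>I. c i * \<gamma> (A i)) \<in> {(\<Sum>i<n. c i * \<gamma> (A i)) | (n::nat) A c.
      zero_partition {..<n} A \<and> (\<forall>i<n. \<forall>x\<in>A i. c i \<le> f x)}"
    using P' by blast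
  then show ?thesis
    unfolding fa_integral_alt
    by (rule cSup_upper) (auto intro!: bdd_aboveI[of _ B] lower_sum_le_bound[where f = f] B)
qed

lemma fa_integral_le:
  assumes B: "\<And>x. B \<le> f x"
    and u: "\<And>n A c. zero_partition {..<n::nat} A \<Longrightarrow> (\<And>i x. i < n \<Longrightarrow> x \<in> A i \<Longrightarrow> c i \<le> f x) \<Longrightarrow>
      (\<Sum>i<n. c i * \<gamma> (A i)) \<le> u"
  shows "fa_integral \<gamma> f \<le> u"
  unfolding fa_integral_alt
proof (rule cSup_least)
  \<comment> \<open>The one-cell partition with value \<open>B\<close> shows that there is a lower
    sum at all, as a least upper bound in the reals needs a nonempty set.\<close>
  have "zero_partition {..<Suc 0} (\<lambda>_. UNIV :: 'a set)"
    by (auto simp: zero_partition_def disjoint_family_on_def zero_algebra.top)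
  then have "(\<Sum>i<Suc 0. (\<lambda>_. B) i * \<gamma> ((\<lambda>_. UNIV) i)) \<in> {(\<Sum>i<n. c i * \<gamma> (A i)) | (n::nat) A c.
      zero_partition {..<n} A \<and> (\<forall>i<n. \<forall>x\<in>A i. c i \<le> f x)}"
    using B by (intro CollectI exI conjI) auto
  then show "{(\<Sum>i<n. c i * \<gamma> (A i)) | (n::nat) A c.
      zero_partition {..<n} A \<and> (\<forall>i<n. \<forall>x\<in>A i. c i \<le> f x)} \<noteq> {}"
    by (metis (lifting) empty_iff)
qed (use u in blast)

text \<open>On the common refinement by the sets \<open>A i \<inter> B j\<close>, a lower sum for
  \<open>f\<close> and one for \<open>g\<close> add up to a lower sum for the sum of the
  functions.\<close>

lemma fa_integral_superadditive:
  assumes f: "f \<in> Cb" and g: "g \<in> Cb"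
  shows "fa_integral \<gamma> f + fa_integral \<gamma> g \<le> fa_integral \<gamma> (\<lambda>x. f x + g x)"
proof -
  obtain Bf where Bf: "\<forall>x. \<bar>f x\<bar> \<le> Bf" using Cb_bound[OF f] by auto
  obtain Bg where Bg: "\<forall>x. \<bar>g x\<bar> \<le> Bg" using Cb_bound[OF g] by auto
  have Bf': "- Bf \<le> f x" "f x \<le> Bf" and Bg': "- Bg \<le> g x" "g x \<le> Bg" for x
    using Bf[rule_format, of x] Bg[rule_format, of x] by auto
  have *: "(\<Sum>i<n. c i * \<gamma> (A i)) + (\<Sum>j<m. d j * \<gamma> (B j)) \<le> fa_integral \<gamma> (\<lambda>x. f x + g x)"
    if A: "zero_partition {..<n::nat} A" "\<And>i x. i < n \<Longrightarrow> x \<in> A i \<Longrightarrow> c i \<le> f x"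
      and B: "zero_partition {..<m::nat} B" "\<And>i x. i < m \<Longrightarrow> x \<in> B i \<Longrightarrow> d i \<le> g x"
    for n m A B c d
  proof -
    have dA: "A i \<inter> A i' = {}" if "i < n" "i' < n" "i \<noteq> i'" for i i'
      using A(1) that by (simp add: zero_partition_def disjoint_family_on_def)
    have dB: "B j \<inter> B j' = {}" if "j < m" "j' < m" "j \<noteq> j'" for j j'
      using B(1) that by (simp add: zero_partition_def disjoint_family_on_def)
    have P: "zero_partition ({..<n} \<times> {..<m}) (\<lambda>(i, j). A i \<inter> B j)"
      unfolding zero_partition_def
    proof (intro conjI)
      show "(\<lambda>(i, j). A i \<inter> B j) ` ({..<n} \<times> {..<m}) \<subseteq> zero_algebra"
        using A(1) B(1) by (auto simp: zero_partition_def)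
      show "disjoint_family_on (\<lambda>(i, j). A i \<inter> B j) ({..<n} \<times> {..<m})"
        unfolding disjoint_family_on_def
      proof clarsimp
        fix i j i' j' assume *: "i < n" "j < m" "i' < n" "j' < m" "i = i' \<longrightarrow> j \<noteq> j'"
        then show "A i \<inter> B j \<inter> (A i' \<inter> B j') = {}"
          using dA[of i i'] dB[of j j'] by (cases "i = i'") auto
      qed
      have "x \<in> (\<Union>(i, j)\<in>{..<n} \<times> {..<m}. A i \<inter> B j)" for x
      proof -
        have "x \<in> (\<Union>i<n. A i)" "x \<in> (\<Union>j<m. B j)"
          using A(1) B(1) by (auto simp: zero_partition_def)
        then show ?thesis by auto
      qed
      then show "(\<Union>(i, j)\<in>{..<n} \<times> {..<m}. A i \<inter> B j) = UNIV" by auto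
    qed simp
    have A1: "\<gamma> (A i) = (\<Sum>j<m. \<gamma> (A i \<inter> B j))" if "i < n" for i
    proof -
      have "A i = (\<Union>j<m. A i \<inter> B j)"
        using B(1) by (auto simp: zero_partition_def)
      also have "\<gamma> \<dots> = (\<Sum>j<m. \<gamma> (A i \<inter> B j))"
        using A(1) B(1) that dB
        by (intro fa_UN) (force simp: zero_partition_def disjoint_family_on_def)+
      finally show ?thesis .
    qed
    have B1: "\<gamma> (B j) = (\<Sum>i<n. \<gamma> (A i \<inter> B j))" if "j < m" for j
    proof -
      have "B j = (\<Union>i<n. A i \<inter> B j)"
        using A(1) by (auto simp: zero_partition_def)
      also have "\<gamma> \<dots> = (\<Sum>i<n. \<gamma> (A i \<inter> B j))"
        using A(1) B(1) that dA
        by (intro fa_UN) (force simp: zero_partition_def disjoint_family_on_def)+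
      finally show ?thesis .
    qed
    have "(\<Sum>i<n. c i * \<gamma> (A i)) = (\<Sum>i<n. \<Sum>j<m. c i * \<gamma> (A i \<inter> B j))"
      by (simp add: A1 sum_distrib_left)
    moreover have "(\<Sum>j<m. d j * \<gamma> (B j)) = (\<Sum>i<n. \<Sum>j<m. d j * \<gamma> (A i \<inter> B j))"
      by (subst sum.swap) (simp add: B1 sum_distrib_left)
    ultimately have "(\<Sum>i<n. c i * \<gamma> (A i)) + (\<Sum>j<m. d j * \<gamma> (B j))
        = (\<Sum>p\<in>{..<n} \<times> {..<m}. (c (fst p) + d (snd p)) * \<gamma> ((\<lambda>(i, j). A i \<inter> B j) p))"
      by (simp add: sum.cartesian_product case_prod_unfold sum.distrib distrib_right)
    also have "\<dots> \<le> fa_integral \<gamma> (\<lambda>x. f x + g x)"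
      by (rule lower_sum_le_fa_integral[OF P, where B = "Bf + Bg"])
         (auto intro!: add_mono A(2) B(2) Bf' Bg')
    finally show ?thesis .
  qed
  \<comment> \<open>The two suprema are taken one after the other: the lower sum of \<open>g\<close>
    stays fixed while that of \<open>f\<close> varies.\<close>
  have "fa_integral \<gamma> f \<le> fa_integral \<gamma> (\<lambda>x. f x + g x) - (\<Sum>j<m. d j * \<gamma> (B j))"
    if "zero_partition {..<m::nat} B" "\<And>i x. i < m \<Longrightarrow> x \<in> B i \<Longrightarrow> d i \<le> g x" for m B d
    by (rule fa_integral_le[OF Bf'(1)]) (use *[OF _ _ that] in \<open>simp add: le_diff_eq\<close>)
  then have "fa_integral \<gamma> g \<le> fa_integral \<gamma> (\<lambda>x. f x + g x) - fa_integral \<gamma> f"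
    by (intro fa_integral_le[OF Bg'(1)]) (simp add: le_diff_eq add.commute)
  then show ?thesis by simp
qed

text \<open>Lower sums of \<open>- f\<close> are negated upper sums of \<open>f\<close>, so this is
  the integrability of \<open>f\<close>: on slices of height \<open>e\<close> an upper and a lower
  sum differ by exactly \<open>e\<close>, as the total mass is 1.\<close>

lemma fa_integral_uminus:
  assumes f: "f \<in> Cb"
  shows "fa_integral \<gamma> (\<lambda>x. - f x) = - fa_integral \<gamma> f"
proof (rule antisym)
  have "fa_integral \<gamma> (\<lambda>x. f x + - f x) \<le> 0"
    by (rule fa_integral_le[of 0]) (auto intro!: lower_sum_le_bound[where f = "\<lambda>_. 0"])
  then show "fa_integral \<gamma> (\<lambda>x. - f x) \<le> - fa_integral \<gamma> f"
    using fa_integral_superadditive[OF f Cb_uminus[OF f]] by simp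
  obtain B where B: "\<forall>x. \<bar>f x\<bar> \<le> B" using Cb_bound[OF f] by auto
  have B': "f x \<le> B" "- f x \<le> B" for x using B[rule_format, of x] by auto
  have "- fa_integral \<gamma> f \<le> fa_integral \<gamma> (\<lambda>x. - f x) + e" if e: "e > 0" for e
  proof -
    \<comment> \<open>Boundedness of \<open>f\<close> leaves finitely many slices. The slice
      \<open>A k\<close> is where \<open>e * k \<le> f z < e * (k + 1)\<close>, a difference of two
      zero-sets.\<close>
    define I where "I = {\<lfloor>- B / e\<rfloor> .. \<lfloor>B / e\<rfloor>}"
    define A where "A k = {z. e * real_of_int k \<le> f z} - {z. e * real_of_int (k + 1) \<le> f z}" for k
    have A_iff: "z \<in> A k \<longleftrightarrow> \<lfloor>f z / e\<rfloor> = k" for z k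
      unfolding A_def using e by (auto simp: floor_eq_iff field_simps)
    have "\<lfloor>f z / e\<rfloor> \<in> I" for z
      unfolding I_def using B'[of z] e by (auto intro!: floor_mono simp: field_simps)
    then have P: "zero_partition I A"
      unfolding zero_partition_def disjoint_family_on_def
      using zero_sets_ge[OF Cb_continuous[OF f]] zero_sets_subset_zero_algebra
      by (auto simp: A_iff I_def) (auto simp: A_def intro!: zero_algebra.Diff)
    have "(\<Sum>k\<in>I. (e * of_int k) * \<gamma> (A k)) \<le> fa_integral \<gamma> f"
      by (rule lower_sum_le_fa_integral[OF P _ B'(1)]) (auto simp: A_def)
    moreover have "(\<Sum>k\<in>I. (- (e * of_int (k + 1))) * \<gamma> (A k)) \<le> fa_integral \<gamma> (\<lambda>x. - f x)"
      by (rule lower_sum_le_fa_integral[OF P _ B'(2)]) (auto simp: A_def)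
    moreover have "(\<Sum>k\<in>I. (e * of_int k) * \<gamma> (A k)) + (\<Sum>k\<in>I. (- (e * of_int (k + 1))) * \<gamma> (A k))
        = - e * (\<Sum>k\<in>I. \<gamma> (A k))"
      by (simp add: sum.distrib[symmetric] sum_distrib_left algebra_simps flip: sum_negf)
    ultimately show ?thesis using zero_partition_sum[OF P] by simp
  qed
  then show "- fa_integral \<gamma> f \<le> fa_integral \<gamma> (\<lambda>x. - f x)"
    by (rule field_le_epsilon)
qed

lemma fa_integral_cmult_pos:
  assumes f: "f \<in> Cb" and a: "a > 0"
  shows "a * fa_integral \<gamma> f \<le> fa_integral \<gamma> (\<lambda>x. a * f x)"
proof -
  obtain B where B: "\<forall>x. \<bar>f x\<bar> \<le> B" using Cb_bound[OF f] by auto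
  have B': "f x \<le> B" "- B \<le> f x" for x using B[rule_format, of x] by auto
  have "fa_integral \<gamma> f \<le> fa_integral \<gamma> (\<lambda>x. a * f x) / a"
  proof (rule fa_integral_le[OF B'(2)])
    fix n A c assume P: "zero_partition {..<n::nat} A" and c: "\<And>i x. i < n \<Longrightarrow> x \<in> A i \<Longrightarrow> c i \<le> f x"
    have "(\<Sum>i<n. (a * c i) * \<gamma> (A i)) \<le> fa_integral \<gamma> (\<lambda>x. a * f x)"
      by (rule lower_sum_le_fa_integral[OF P, of _ _ "a * B"]) (use a c B' in auto)
    then show "(\<Sum>i<n. c i * \<gamma> (A i)) \<le> fa_integral \<gamma> (\<lambda>x. a * f x) / a"
      using a by (simp add: field_simps sum_distrib_left mult_ac)
  qed
  then show ?thesis using a by (simp add: field_simps)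
qed

lemma mean_functional_fa_integral: "mean_functional (fa_integral \<gamma>)"
  unfolding mean_functional_def
proof (intro conjI ballI allI impI)
  show nonneg: "0 \<le> fa_integral \<gamma> f" if "f \<in> Cb" "\<forall>z. 0 \<le> f z" for f
  proof -
    obtain B where "\<forall>x. \<bar>f x\<bar> \<le> B" using Cb_bound[OF \<open>f \<in> Cb\<close>] by auto
    then have "(\<Sum>i\<in>{0::nat}. 0 * \<gamma> UNIV) \<le> fa_integral \<gamma> f"
      using that
      by (intro lower_sum_le_fa_integral[where B = B])
         (auto simp: zero_partition_def disjoint_family_on_def zero_algebra.top abs_le_iff)
    then show ?thesis by simp
  qed
  \<comment> \<open>Superadditivity for \<open>- f\<close> and \<open>- g\<close>, combined with
    oddness, is subadditivity for \<open>f\<close> and \<open>g\<close>.\<close>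
  show "fa_integral \<gamma> (\<lambda>z. f z + g z) = fa_integral \<gamma> f + fa_integral \<gamma> g"
    if "f \<in> Cb" "g \<in> Cb" for f g
    using fa_integral_superadditive[OF that] fa_integral_uminus[OF Cb_add[OF that]]
      fa_integral_superadditive[OF Cb_uminus[OF that(1)] Cb_uminus[OF that(2)]]
      fa_integral_uminus[OF that(1)] fa_integral_uminus[OF that(2)]
    by simp
  show "fa_integral \<gamma> (\<lambda>z. a * f z) = a * fa_integral \<gamma> f" if f: "f \<in> Cb" for a f
  proof -
    \<comment> \<open>Scaling by \<open>a\<close> and then back by \<open>1 / a\<close> turns the
      one-sided estimate into an equality.\<close>
    have pos: "fa_integral \<gamma> (\<lambda>z. a * f z) = a * fa_integral \<gamma> f" if "f \<in> Cb" "a > 0" for a f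
      using fa_integral_cmult_pos[OF that] fa_integral_cmult_pos[OF Cb_cmult[OF that(1)], of "1 / a" a] that
      by (simp add: field_simps)
    consider "a > 0" | "a = 0" | "a < 0" by linarith
    then show ?thesis
    proof cases
      case 2
      \<comment> \<open>Oddness at the zero function gives a real number equal to its own
        negative.\<close>
      then show ?thesis using fa_integral_uminus[OF Cb_const, of 0] by simp
    next
      case 3
      then show ?thesis using pos[OF Cb_uminus[OF f], of "- a"] fa_integral_uminus[OF f] by simp
    qed (simp add: pos f)
  qed
  have one: "(\<Sum>i\<in>{0::nat}. c * \<gamma> UNIV) \<le> fa_integral \<gamma> (\<lambda>_. c)" for c
    by (rule lower_sum_le_fa_integral[where B = "c"])
       (auto simp: zero_partition_def disjoint_family_on_def zero_algebra.top)
  show "fa_integral \<gamma> (\<lambda>_. 1) = 1"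
    using one[of 1] one[of "-1"] fa_integral_uminus[OF Cb_const, of 1] by (simp add: fa_UNIV)
qed

end

subsection \<open>Riesz representation for tight functionals\<close>

text \<open>Functions are asked to vanish off \<open>G\<close>, not to have their closed support
  inside \<open>G\<close>. Where a gap to the complement is needed, it is created by truncating at a
  small height.\<close>

definition unit_below :: "'a::topological_space set \<Rightarrow> ('a \<Rightarrow> real) set" where
  "unit_below G = {f \<in> Cb. (\<forall>z. 0 \<le> f z \<and> f z \<le> 1) \<and> (\<forall>z. z \<notin> G \<longrightarrow> f z = 0)}"

text \<open>A functional has no values on sets, so the smallness of the mass outside
  \<open>K\<close> is tested by functions that vanish on \<open>K\<close>.\<close>

definition tight_functional :: "(('a::topological_space \<Rightarrow> real) \<Rightarrow> real) \<Rightarrow> bool" where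
  "tight_functional L \<longleftrightarrow> (\<forall>e>0. \<exists>K. compact K \<and> (\<forall>f\<in>unit_below (- K). L f \<le> e))"

definition open_content :: "(('a::topological_space \<Rightarrow> real) \<Rightarrow> real) \<Rightarrow> 'a set \<Rightarrow> ennreal" where
  "open_content L G = (SUP f\<in>unit_below G. ennreal (L f))"

definition radon_outer :: "(('a::topological_space \<Rightarrow> real) \<Rightarrow> real) \<Rightarrow> 'a set \<Rightarrow> ennreal" where
  "radon_outer L A = (INF G\<in>{G. open G \<and> A \<subseteq> G}. open_content L G)"

lemma unit_below_zero: "(\<lambda>_. 0) \<in> unit_below G"
  by (simp add: unit_below_def Cb_const)

lemma unit_below_mono: "G \<subseteq> H \<Longrightarrow> unit_below G \<subseteq> unit_below H"
  by (auto simp: unit_below_def)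

lemma completely_regular_separation:
  fixes x :: "'a::topological_space"
  assumes "completely_regular_space (euclidean :: 'a topology)" "open U" "x \<in> U"
  shows "\<exists>h\<in>unit_below U. h x = 1"
proof -
  have "closedin (euclidean :: 'a topology) (- U)" "x \<in> topspace euclidean - (- U)"
    using assms by auto
  then obtain f :: "'a \<Rightarrow> real" where f: "continuous_map euclidean (top_of_set {0..1}) f"
      "f x = 0" "f ` (- U) \<subseteq> {1}"
    using assms(1) unfolding completely_regular_space_def by meson
  have c: "continuous_on UNIV f" and r: "\<And>z. f z \<in> {0..1}"
    using f(1) by (auto simp: continuous_map_in_subtopology)
  have "(\<lambda>z. 1 - f z) \<in> Cb"
    by (rule CbI[of _ 1]) (use r in \<open>auto intro!: continuous_intros c simp: abs_le_iff\<close>)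
  then show ?thesis
    using f r by (intro bexI[of _ "\<lambda>z. 1 - f z"]) (auto simp: unit_below_def)
qed

lemma open_content_mono: "G \<subseteq> H \<Longrightarrow> open_content L G \<le> open_content L H"
  unfolding open_content_def by (rule SUP_subset_mono[OF unit_below_mono]) auto

lemma radon_outer_mono: "A \<subseteq> B \<Longrightarrow> radon_outer L A \<le> radon_outer L B"
  unfolding radon_outer_def by (rule INF_superset_mono) auto

lemma radon_outer_open: "open G \<Longrightarrow> radon_outer L G = open_content L G"
  unfolding radon_outer_def
  by (intro antisym INF_lower INF_greatest open_content_mono) auto

lemma radon_outer_le: "open G \<Longrightarrow> A \<subseteq> G \<Longrightarrow> radon_outer L A \<le> open_content L G"
  unfolding radon_outer_def by (rule INF_lower) auto

section \<open>Caratheodory construction from a tight functional\<close>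

context
  fixes L :: "('a::t2_space \<Rightarrow> real) \<Rightarrow> real"
  assumes mean: "mean_functional L" and tight: "tight_functional L"
    and CR: "completely_regular_space (euclidean :: 'a topology)"
begin

lemma unit_below_Cb: "f \<in> unit_below G \<Longrightarrow> f \<in> Cb"
  by (simp add: unit_below_def)

lemma unit_below_nonneg: "f \<in> unit_below G \<Longrightarrow> 0 \<le> L f"
  by (rule mean_nonneg[OF mean]) (auto simp: unit_below_def)

lemma le_open_content: "f \<in> unit_below G \<Longrightarrow> ennreal (L f) \<le> open_content L G"
  unfolding open_content_def by (rule SUP_upper)

text \<open>Cutting \<open>f\<close> down by \<open>d\<close> costs at most \<open>d\<close> because
  \<open>L\<close> is normalised. This is what allows a function that is merely small on a set to be
  replaced by one that vanishes there.\<close>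

lemma mean_le_truncation:
  assumes "f \<in> Cb" "0 \<le> d"
  shows "L f \<le> L (\<lambda>z. max (f z - d) 0) + d"
proof -
  have "L f \<le> L (\<lambda>z. max (f z - d) 0 + d)"
    using assms by (intro mean_mono[OF mean] Cb_add Cb_max Cb_diff Cb_const) auto
  also have "\<dots> = L (\<lambda>z. max (f z - d) 0) + d"
    using assms mean_add[OF mean Cb_max[OF Cb_diff[OF _ Cb_const] Cb_const] Cb_const, of f d 0 d]
    by (simp add: mean_const[OF mean])
  finally show ?thesis .
qed

text \<open>The finite subcover lives on a compact set that carries \<open>L\<close> up to \<open>e\<close>; on it the function
  \<open>f\<close> is split by a partition of unity subordinate to the cover, with \<open>max S (1/2)\<close> in place of
  the sum \<open>S\<close> to keep the denominators away from zero.\<close>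
lemma open_content_subadditive:
  fixes G :: "nat \<Rightarrow> 'a set"
  assumes G: "\<And>n. open (G n)"
  shows "open_content L (\<Union>n. G n) \<le> (\<Sum>n. open_content L (G n))"
  unfolding open_content_def[of L "\<Union>n. G n"]
proof (rule SUP_least)
  fix f assume f: "f \<in> unit_below (\<Union>n. G n)"
  note fC = unit_below_Cb[OF f]
  have f01: "0 \<le> f z" "f z \<le> 1" and f0: "z \<notin> (\<Union>n. G n) \<Longrightarrow> f z = 0" for z
    using f by (auto simp: unit_below_def)
  show "ennreal (L f) \<le> (\<Sum>n. open_content L (G n))"
  proof (rule ennreal_le_epsilon)
    fix e :: real assume e: "e > 0"
    then obtain K where K: "compact K" and KL: "\<And>h. h \<in> unit_below (- K) \<Longrightarrow> L h \<le> e / 2"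
      using tight unfolding tight_functional_def by (meson half_gt_zero)
    \<comment> \<open>\<open>K\<close> need not lie in the union of the \<open>G n\<close>, but the
      part where \<open>f\<close> is at least \<open>e / 2\<close> does, because \<open>f\<close>
      vanishes off the union. On the rest of \<open>K\<close> the function is already small.\<close>
    define F where "F = K \<inter> {z. e / 2 \<le> f z}"
    have "closed {z. e / 2 \<le> f z}"
      by (intro closed_Collect_le continuous_on_const Cb_continuous fC)
    then have F: "compact F"
      unfolding F_def by (rule compact_Int_closed[OF K])
    have "\<exists>n h. x \<in> F \<longrightarrow> h \<in> unit_below (G n) \<and> h x = 1" for x
    proof (cases "x \<in> F")
      case True
      then have "f x \<noteq> 0" using e by (auto simp: F_def)
      then obtain n where "x \<in> G n" using f0 by auto
      then show ?thesis using completely_regular_separation[OF CR G] by blast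
    qed auto
    then obtain n h where nh: "\<And>x. x \<in> F \<Longrightarrow> h x \<in> unit_below (G (n x))" "\<And>x. x \<in> F \<Longrightarrow> h x x = 1"
      by metis
    have hC: "h x \<in> Cb" if "x \<in> F" for x
      using nh(1)[OF that] by (rule unit_below_Cb)
    have h01: "0 \<le> h x z" "h x z \<le> 1" and h0: "z \<notin> G (n x) \<Longrightarrow> h x z = 0" if "x \<in> F" for x z
      using nh(1)[OF that] by (auto simp: unit_below_def)
    \<comment> \<open>The level 1/2 is the constant in \<open>D\<close> below: every point of
      \<open>F\<close> has a selected \<open>h x\<close> above it, so \<open>S\<close> exceeds 1/2
      there and the quotient is exact on \<open>F\<close>.\<close>
    have op: "open {z. 1 / 2 < h x z}" if "x \<in> F" for x
      by (intro open_Collect_less continuous_on_const Cb_continuous hC that)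
    have cov: "F \<subseteq> (\<Union>x\<in>F. {z. 1 / 2 < h x z})"
    proof
      fix x assume "x \<in> F"
      then show "x \<in> (\<Union>x\<in>F. {z. 1 / 2 < h x z})" by (intro UN_I[of x]) (simp_all add: nh(2))
    qed
    obtain T where T: "T \<subseteq> F" "finite T" "F \<subseteq> (\<Union>x\<in>T. {z. 1 / 2 < h x z})"
      by (rule compactE_image[OF F op cov])
    define S where "S z = (\<Sum>x\<in>T. h x z)" for z
    have SC: "S \<in> Cb" unfolding S_def using T hC by (intro Cb_sum) auto
    have hS: "h x z \<le> S z" if "x \<in> T" for x z
      unfolding S_def by (rule member_le_sum) (use that T h01 in auto)
    have S0: "0 \<le> S z" for z
      unfolding S_def by (rule sum_nonneg) (use T h01 in auto)
    have S_half: "1 / 2 < S z" if "z \<in> F" for z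
      using that T hS by (force intro: less_le_trans)
    define D where "D z = 1 / max (S z) (1 / 2)" for z
    have DC: "D \<in> Cb" unfolding D_def
    proof (rule CbI[of _ 2])
      show "continuous_on UNIV (\<lambda>z. 1 / max (S z) (1 / 2))"
        by (intro continuous_on_divide continuous_on_max continuous_on_const Cb_continuous[OF SC]) auto
      show "\<bar>1 / max (S z) (1 / 2)\<bar> \<le> 2" for z
        by (auto simp: max_def field_simps)
    qed
    have D0: "0 \<le> D z" and SD: "S z * D z \<le> 1" for z
      using S0[of z] by (auto simp: D_def max_def field_simps)
    have SD1: "S z * D z = 1" if "z \<in> F" for z
      using S_half[OF that] by (simp add: D_def max_def)
    define g where "g x z = f z * (h x z * D z)" for x z
    have gC: "g x \<in> Cb" if "x \<in> T" for x
      unfolding g_def using that T by (intro Cb_mult fC hC DC) auto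
    have g0: "0 \<le> g x z" if "x \<in> T" for x z
      unfolding g_def using that T h01 f01 D0 by (intro mult_nonneg_nonneg) auto
    have gsum: "(\<Sum>x\<in>T. g x z) = f z * (S z * D z)" for z
      by (simp add: g_def S_def sum_distrib_left sum_distrib_right)
    have gsum_le: "(\<Sum>x\<in>T. g x z) \<le> f z" for z
      unfolding gsum using mult_left_mono[OF SD f01(1)] by simp
    define N where "N = n ` T"
    \<comment> \<open>Several points of the subcover may be assigned the same \<open>G k\<close>.
      Their pieces are merged, so that each open set is charged once in the final sum.\<close>
    define gg where "gg k z = (\<Sum>x\<in>{x\<in>T. n x = k}. g x z)" for k z
    have gg: "gg k \<in> unit_below (G k)" for k
      unfolding unit_below_def
    proof (intro CollectI conjI allI impI)
      show "gg k \<in> Cb" unfolding gg_def using gC by (intro Cb_sum) auto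
      show "0 \<le> gg k z" for z unfolding gg_def using g0 by (intro sum_nonneg) auto
      have "gg k z \<le> (\<Sum>x\<in>T. g x z)" for z
        unfolding gg_def using g0 T by (intro sum_mono2) auto
      then show "gg k z \<le> 1" for z using gsum_le f01 by (meson order_trans)
      show "gg k z = 0" if "z \<notin> G k" for z
        unfolding gg_def g_def using h0 T that by (intro sum.neutral) auto
    qed
    define r where "r z = f z - (\<Sum>x\<in>T. g x z)" for z
    have rC: "r \<in> Cb" unfolding r_def using gC by (intro Cb_diff fC Cb_sum) auto
    have r0: "0 \<le> r z" and r1: "r z \<le> 1" for z
      using gsum_le[of z] f01[of z] sum_nonneg[of T "\<lambda>x. g x z"] g0 by (auto simp: r_def)
    have rK: "r z \<le> e / 2" if "z \<in> K" for z
    proof (cases "z \<in> F")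
      case True
      then show ?thesis using e SD1[OF True] by (simp add: r_def gsum)
    next
      case False
      then have "f z \<le> e / 2" using that by (simp add: F_def)
      then show ?thesis
        using sum_nonneg[of T "\<lambda>x. g x z"] g0 by (auto simp: r_def)
    qed
    \<comment> \<open>The remainder \<open>r\<close> is at most \<open>e / 2\<close> on
      \<open>K\<close>, so its truncation vanishes there. Tightness bounds the truncation by
      \<open>e / 2\<close> and the truncation itself costs another \<open>e / 2\<close>.\<close>
    have "(\<lambda>z. max (r z - e / 2) 0) \<in> unit_below (- K)"
      using e rK r0 r1 rC
      by (auto simp: unit_below_def intro!: Cb_max Cb_diff Cb_const)
        (meson diff_le_eq add_increasing2 less_imp_le half_gt_zero order_trans)+
    then have "L r \<le> e"
      using mean_le_truncation[OF rC, of "e / 2"] KL[of "\<lambda>z. max (r z - e / 2) 0"] e by simp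
    moreover have "L r = L f - (\<Sum>k\<in>N. L (gg k))"
    proof -
      have "(\<lambda>z. \<Sum>x\<in>T. g x z) = (\<lambda>z. \<Sum>k\<in>N. gg k z)"
        unfolding gg_def N_def using T by (intro ext sum.image_gen) auto
      moreover have "L (\<lambda>z. \<Sum>k\<in>N. gg k z) = (\<Sum>k\<in>N. L (gg k))"
        using T by (intro mean_sum[OF mean] unit_below_Cb[OF gg]) (simp add: N_def)
      ultimately show ?thesis
        unfolding r_def using gC by (subst mean_diff[OF mean]) (auto intro!: fC Cb_sum unit_below_Cb[OF gg])
    qed
    ultimately have "L f \<le> (\<Sum>k\<in>N. L (gg k)) + e" by simp
    then have "ennreal (L f) \<le> ennreal ((\<Sum>k\<in>N. L (gg k)) + e)"
      by (rule ennreal_leI)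
    also have "\<dots> = (\<Sum>k\<in>N. ennreal (L (gg k))) + ennreal e"
      using e unit_below_nonneg[OF gg] by (simp add: sum_nonneg sum_ennreal)
    also have "(\<Sum>k\<in>N. ennreal (L (gg k))) \<le> (\<Sum>k\<in>N. open_content L (G k))"
      by (intro sum_mono le_open_content gg)
    also have "\<dots> \<le> (\<Sum>n. open_content L (G n))"
      using T by (intro sum_le_suminf) (auto simp: N_def)
    finally show "ennreal (L f) \<le> (\<Sum>n. open_content L (G n)) + ennreal e"
      by (simp add: add_right_mono)
  qed
qed

lemma open_content_empty: "open_content L {} = 0"
proof -
  have "unit_below {} = {\<lambda>_::'a. 0 :: real}"
    using unit_below_zero by (fastforce simp: unit_below_def)
  then show ?thesis
    by (simp add: open_content_def mean_const[OF mean])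
qed

lemma open_content_UNIV: "open_content L UNIV = 1"
  unfolding open_content_def
proof (intro antisym SUP_least)
  fix f :: "'a \<Rightarrow> real" assume "f \<in> unit_below UNIV"
  then have "L f \<le> L (\<lambda>_. 1)"
    by (intro mean_mono[OF mean] Cb_const) (auto simp: unit_below_def)
  then show "ennreal (L f) \<le> 1" by (simp add: mean_one[OF mean])
next
  have "(\<lambda>_::'a. 1) \<in> unit_below UNIV" by (simp add: unit_below_def Cb_const)
  then have "ennreal (L (\<lambda>_. 1)) \<le> (SUP f\<in>unit_below UNIV. ennreal (L f))" by (rule SUP_upper)
  then show "1 \<le> (SUP f\<in>unit_below UNIV. ennreal (L f))" by (simp add: mean_one[OF mean])
qed

lemma radon_outer_finite: "radon_outer L A < top"
proof -
  have "radon_outer L A \<le> 1"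
    using radon_outer_mono[of A UNIV L] by (simp add: radon_outer_open open_content_UNIV)
  then show ?thesis by (meson ennreal_one_less_top order_le_less_trans)
qed

lemma radon_outer_approx:
  assumes "e > 0" shows "\<exists>G. open G \<and> A \<subseteq> G \<and> open_content L G < radon_outer L A + ennreal e"
proof -
  have "radon_outer L A < radon_outer L A + ennreal e"
    using assms radon_outer_finite[of A] by auto
  then show ?thesis
    by (subst (asm) (1) radon_outer_def) (auto simp: INF_less_iff)
qed

lemma outer_measure_space_radon_outer: "outer_measure_space UNIV (radon_outer L)"
  unfolding outer_measure_space_def
proof (intro conjI)
  show "positive UNIV (radon_outer L)"
    by (simp add: positive_def radon_outer_open open_content_empty)
  show "increasing UNIV (radon_outer L)"
    by (simp add: increasing_def radon_outer_mono)
  show "countably_subadditive UNIV (radon_outer L)"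
    unfolding countably_subadditive_def
  proof (intro allI impI)
    fix A :: "nat \<Rightarrow> 'a set"
    show "radon_outer L (\<Union>i. A i) \<le> (\<Sum>i. radon_outer L (A i))"
    proof (rule ennreal_le_epsilon)
      fix e :: real assume e: "e > 0"
      \<comment> \<open>The allowances \<open>e / 2^(n+1)\<close> sum to \<open>e\<close> and reduce
        the claim to open sets.\<close>
      have "\<exists>G. open G \<and> A n \<subseteq> G \<and> open_content L G < radon_outer L (A n) + ennreal (e * (1/2) ^ Suc n)" for n
        using e by (intro radon_outer_approx) auto
      then obtain G where G: "\<And>n. open (G n)" "\<And>n. A n \<subseteq> G n"
          "\<And>n. open_content L (G n) < radon_outer L (A n) + ennreal (e * (1/2) ^ Suc n)"
        by metis
      have "radon_outer L (\<Union>i. A i) \<le> open_content L (\<Union>i. G i)"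
        using G by (intro radon_outer_le) auto
      also have "\<dots> \<le> (\<Sum>n. open_content L (G n))"
        by (rule open_content_subadditive[OF G(1)])
      also have "\<dots> \<le> (\<Sum>n. radon_outer L (A n) + ennreal (e * (1/2) ^ Suc n))"
        by (intro suminf_le less_imp_le G) auto
      also have "\<dots> = (\<Sum>n. radon_outer L (A n)) + (\<Sum>n. ennreal (e * (1/2) ^ Suc n))"
        by (intro suminf_add[symmetric]) auto
      also have "(\<Sum>n. ennreal (e * (1/2) ^ Suc n)) = ennreal e"
        using e sums_mult[OF power_half_series, of e] by (intro suminf_ennreal_eq) auto
      finally show "radon_outer L (\<Union>i. A i) \<le> (\<Sum>n. radon_outer L (A n)) + ennreal e" .
    qed
  qed
qed

text \<open>This is the nontrivial half of Caratheodory measurability of open sets. Let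
  \<open>U\<close> be open around \<open>A\<close> and \<open>f\<close> below
  \<open>U \<inter> G\<close>. The closed set \<open>F\<close> where \<open>f \<ge> d\<close> lies
  in \<open>G\<close>, so \<open>U - F\<close> is an open neighbourhood of \<open>A - G\<close>. A
  competitor \<open>g\<close> for \<open>U - F\<close> vanishes wherever the truncation of
  \<open>f\<close> at height \<open>d\<close> is positive, so their sum still competes for
  \<open>U\<close>.\<close>

lemma radon_outer_split_open:
  assumes G: "open G"
  shows "radon_outer L (A \<inter> G) + radon_outer L (A - G) \<le> radon_outer L A"
  unfolding radon_outer_def[of L A]
proof (rule INF_greatest, clarify)
  fix U assume U: "open U" "A \<subseteq> U"
  have *: "ennreal (L f) + radon_outer L (A - G) \<le> open_content L U" if f: "f \<in> unit_below (U \<inter> G)" for f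
  proof (rule ennreal_le_epsilon)
    fix d :: real assume d: "d > 0"
    note fC = unit_below_Cb[OF f]
    have f01: "0 \<le> f z" "f z \<le> 1" and f0: "z \<notin> U \<Longrightarrow> f z = 0" "z \<notin> G \<Longrightarrow> f z = 0" for z
      using f by (auto simp: unit_below_def)
    define F where "F = {z. d \<le> f z}"
    define f' where "f' z = max (f z - d) 0" for z
    have f'C: "f' \<in> Cb" unfolding f'_def by (intro Cb_max Cb_diff Cb_const fC)
    have "closed F" unfolding F_def
      by (intro closed_Collect_le continuous_on_const Cb_continuous fC)
    then have oUF: "open (U - F)" using U by (intro open_Diff)
    have "A - G \<subseteq> U - F" using U d f0 by (force simp: F_def)
    then have "radon_outer L (A - G) \<le> open_content L (U - F)"
      by (rule radon_outer_le[OF oUF])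
    then have "ennreal (L f') + radon_outer L (A - G) \<le> ennreal (L f') + open_content L (U - F)"
      by (rule add_left_mono)
    also have "\<dots> \<le> open_content L U"
      unfolding open_content_def[of L "U - F"]
    proof (subst ennreal_SUP_add_right)
      show "unit_below (U - F) \<noteq> {}" using unit_below_zero by blast
      show "(SUP g\<in>unit_below (U - F). ennreal (L f') + ennreal (L g)) \<le> open_content L U"
      proof (rule SUP_least)
        fix g assume g: "g \<in> unit_below (U - F)"
        have g01: "0 \<le> g z" "g z \<le> 1" and g0: "z \<notin> U \<Longrightarrow> g z = 0" "z \<in> F \<Longrightarrow> g z = 0" for z
          using g by (auto simp: unit_below_def)
        have "(\<lambda>z. f' z + g z) \<in> unit_below U"
          unfolding unit_below_def
        proof (intro CollectI conjI allI impI)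
          show "(\<lambda>z. f' z + g z) \<in> Cb" by (intro Cb_add f'C unit_below_Cb[OF g])
          show "0 \<le> f' z + g z" for z using g01 by (simp add: f'_def)
          show "f' z + g z \<le> 1" for z
            using g01[of z] g0(2)[of z] f01[of z] d by (cases "z \<in> F") (auto simp: f'_def F_def)
          show "f' z + g z = 0" if "z \<notin> U" for z
            using that g0 f0 d by (simp add: f'_def)
        qed
        then have "ennreal (L (\<lambda>z. f' z + g z)) \<le> open_content L U" by (rule le_open_content)
        moreover have "0 \<le> L f'" by (rule mean_nonneg[OF mean f'C]) (simp add: f'_def)
        ultimately show "ennreal (L f') + ennreal (L g) \<le> open_content L U"
          using mean_add[OF mean f'C unit_below_Cb[OF g]] unit_below_nonneg[OF g] by simp
      qed
    qed
    finally have 1: "ennreal (L f') + radon_outer L (A - G) \<le> open_content L U" .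
    have "0 \<le> L f'" by (rule mean_nonneg[OF mean f'C]) (simp add: f'_def)
    then have "ennreal (L f) \<le> ennreal (L f') + ennreal d"
      using mean_le_truncation[OF fC, of d] d unfolding f'_def[symmetric]
      by (simp add: ennreal_leI flip: ennreal_plus)
    then have "ennreal (L f) + radon_outer L (A - G) \<le> ennreal (L f') + radon_outer L (A - G) + ennreal d"
      by (metis add.assoc add.commute add_right_mono)
    also have "\<dots> \<le> open_content L U + ennreal d"
      using 1 by (rule add_right_mono)
    finally show "ennreal (L f) + radon_outer L (A - G) \<le> open_content L U + ennreal d" .
  qed
  have "radon_outer L (A \<inter> G) + radon_outer L (A - G) \<le> open_content L (U \<inter> G) + radon_outer L (A - G)"
    using U G by (intro add_right_mono radon_outer_le) auto
  also have "\<dots> = (SUP f\<in>unit_below (U \<inter> G). ennreal (L f) + radon_outer L (A - G))"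
    unfolding open_content_def using unit_below_zero by (subst ennreal_SUP_add_left) auto
  also have "\<dots> \<le> open_content L U" by (rule SUP_least) (rule *)
  finally show "radon_outer L (A \<inter> G) + radon_outer L (A - G) \<le> open_content L U" .
qed

lemma measure_space_radon_outer: "measure_space UNIV (sigma_sets UNIV {S. open S}) (radon_outer L)"
proof -
  interpret P: sigma_algebra UNIV "UNIV :: 'a set set"
    using sigma_algebra_Pow[of UNIV] by simp
  have sub: "subadditive UNIV (radon_outer L)"
    using outer_measure_space_radon_outer
    by (intro P.countably_subadditive_subadditive) (auto simp: outer_measure_space_def)
  have ms: "measure_space UNIV (lambda_system UNIV UNIV (radon_outer L)) (radon_outer L)"
    by (rule P.caratheodory_lemma[OF outer_measure_space_radon_outer])
  have "{S. open S} \<subseteq> lambda_system UNIV UNIV (radon_outer L)"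
  proof (auto simp: P.lambda_system_eq)
    fix G A :: "'a set" assume "open G"
    have "A \<inter> G \<union> (A - G) = A" by auto
    then show "radon_outer L (A \<inter> G) + radon_outer L (A - G) = radon_outer L A"
      using subadditiveD[OF sub, of "A \<inter> G" "A - G"] radon_outer_split_open[OF \<open>open G\<close>, of A]
      by (intro antisym) auto
  qed
  then have "sigma_sets UNIV {S. open S} \<subseteq> lambda_system UNIV UNIV (radon_outer L)"
    using ms by (intro sigma_algebra.sigma_sets_subset) (auto simp: measure_space_def)
  then show ?thesis
    by (intro measure_down[OF ms] sigma_algebra_sigma_sets) auto
qed

text \<open>\<open>measure_of\<close> keeps the given set function only if it is a measure on the
  generated sigma-algebra, and is 0 otherwise; \<open>measure_space_radon_outer\<close> guarantees
  the former.\<close>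

definition "radon_measure = measure_of UNIV {S. open S} (radon_outer L)"

lemma sets_radon_measure [simp, measurable_cong]: "sets radon_measure = sets borel"
  by (simp add: radon_measure_def sets_borel)

lemma space_radon_measure [simp]: "space radon_measure = UNIV"
  by (simp add: radon_measure_def space_measure_of_conv)

lemma emeasure_radon_measure: "B \<in> sets borel \<Longrightarrow> emeasure radon_measure B = radon_outer L B"
  using measure_space_radon_outer
  by (simp add: radon_measure_def emeasure_measure_of_conv sets_borel)

lemma prob_space_radon_measure: "prob_space radon_measure"
  by (rule prob_spaceI) (simp add: emeasure_radon_measure radon_outer_open open_content_UNIV)

text \<open>Outer regularity comes from the construction and tightness converts it into inner
  regularity: if the open set \<open>G\<close> covers \<open>- B\<close> with little excess, then
  \<open>K - G\<close> is a compact subset of \<open>B\<close>, and what it misses lies in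
  \<open>G \<inter> B\<close> or outside \<open>K\<close>.\<close>

lemma radon_prob_radon_measure: "radon_prob radon_measure"
  unfolding radon_prob_def
proof (intro conjI ballI allI impI prob_space_radon_measure)
  interpret prob_space radon_measure by (rule prob_space_radon_measure)
  fix B :: "'a set" and e :: real assume B: "B \<in> sets borel" and e: "e > 0"
  obtain K where K: "compact K" and KL: "\<And>h. h \<in> unit_below (- K) \<Longrightarrow> L h \<le> e / 3"
    using tight e unfolding tight_functional_def by (metis divide_pos_pos zero_less_numeral)
  have clK: "closed K" using K by (rule compact_imp_closed)
  have "open_content L (- K) \<le> ennreal (e / 3)"
    unfolding open_content_def by (intro SUP_least ennreal_leI KL)
  then have "emeasure radon_measure (- K) \<le> ennreal (e / 3)"
    using clK by (simp add: emeasure_radon_measure radon_outer_open open_Compl)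
  then have mK: "measure radon_measure (- K) \<le> e / 3"
    using e by (simp add: emeasure_eq_measure)
  obtain G where G: "open G" "- B \<subseteq> G" "open_content L G < radon_outer L (- B) + ennreal (e / 3)"
    using radon_outer_approx[of "e / 3" "- B"] e by auto
  have [measurable]: "B \<in> sets borel" "G \<in> sets borel" "K \<in> sets borel"
    using B G clK by auto
  have "emeasure radon_measure G < emeasure radon_measure (- B) + ennreal (e / 3)"
    using G B by (simp add: emeasure_radon_measure radon_outer_open borel_comp)
  then have "measure radon_measure G < measure radon_measure (- B) + e / 3"
    using e by (simp add: emeasure_eq_measure ennreal_less_iff flip: ennreal_plus)
  moreover have "measure radon_measure G = measure radon_measure (- B) + measure radon_measure (G \<inter> B)"
    using G(2) by (subst finite_measure_Union[symmetric]) (auto intro!: arg_cong[where f = "measure _"])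
  ultimately have mG: "measure radon_measure (G \<inter> B) < e / 3" by simp
  have "B - (K - G) \<subseteq> (G \<inter> B) \<union> - K" by auto
  then have "measure radon_measure (B - (K - G)) \<le> measure radon_measure ((G \<inter> B) \<union> - K)"
    by (intro finite_measure_mono) auto
  also have "\<dots> \<le> measure radon_measure (G \<inter> B) + measure radon_measure (- K)"
    by (intro measure_Un_le) auto
  also have "\<dots> < e" using mG mK e by simp
  finally have "measure radon_measure (B - (K - G)) < e" .
  moreover have "compact (K - G)" using K G by (simp add: compact_diff)
  moreover have "K - G \<subseteq> B" using G by auto
  ultimately show "\<exists>K. compact K \<and> K \<subseteq> B \<and> measure radon_measure (B - K) < e" by blast
qed simp

text \<open>A layer-cake argument: \<open>f\<close> is cut into \<open>n\<close> layers
  \<open>s k\<close> of height \<open>1 / n\<close>. The rescaled layer lies below the indicator of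
  the open set \<open>G k\<close>, so \<open>L\<close> of the layer is at most the measure of
  \<open>G k\<close> divided by \<open>n\<close>, while the sum of these indicators over
  \<open>n\<close> overshoots \<open>f\<close> by at most \<open>1 / n\<close>.\<close>

lemma mean_le_radon_integral_unit:
  assumes f: "f \<in> Cb" and f01: "\<And>z. 0 \<le> f z" "\<And>z. f z \<le> 1"
  shows "L f \<le> (\<integral>z. f z \<partial>radon_measure)"
proof -
  interpret prob_space radon_measure by (rule prob_space_radon_measure)
  have fm[measurable]: "f \<in> borel_measurable borel"
    by (rule borel_measurable_continuous_onI[OF Cb_continuous[OF f]])
  have fi: "integrable radon_measure f"
    by (rule integrable_const_bound[of _ 1]) (use f01 in auto)
  have "L f \<le> (\<integral>z. f z \<partial>radon_measure) + 1 / n" if n: "n > 0" for n :: nat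
  proof -
    define G where "G k = {z. k / n < f z}" for k :: nat
    have oG: "open (G k)" for k
      unfolding G_def by (intro open_Collect_less continuous_on_const Cb_continuous f)
    have [measurable]: "G k \<in> sets borel" for k using oG by auto
    define s where "s k z = min (f z) (real (Suc k) / n) - min (f z) (k / n)" for k z
    have sC: "s k \<in> Cb" for k unfolding s_def by (intro Cb_diff Cb_min Cb_const f)
    have step: "real (Suc k) / n = k / n + 1 / n" for k by (simp add: add_divide_distrib)
    have min_step: "0 \<le> min a (b + c) - min a b \<and> min a (b + c) - min a b \<le> c"
      if "0 \<le> c" for a b c :: real
      using that by (auto simp: min_def)
    have sG: "(\<lambda>z. n * s k z) \<in> unit_below (G k)" for k
      unfolding unit_below_def
    proof (intro CollectI conjI allI impI)
      show "(\<lambda>z. n * s k z) \<in> Cb" by (intro Cb_cmult sC)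
      have s0: "0 \<le> s k z" and s1: "s k z \<le> 1 / n" for z
        unfolding s_def step using min_step[of "1 / n" "f z" "k / n"] by auto
      show "0 \<le> n * s k z" for z using s0 by simp
      show "n * s k z \<le> 1" for z using s1[of z] n by (simp add: field_simps)
      show "n * s k z = 0" if "z \<notin> G k" for z
      proof -
        have "f z \<le> k / n" "f z \<le> k / n + 1 / n"
          using that by (auto simp: G_def add_increasing2)
        then show ?thesis unfolding s_def step by (simp only: min_absorb1) simp
      qed
    qed
    have Ls: "L (s k) \<le> measure radon_measure (G k) / n" for k
    proof -
      have "ennreal (n * L (s k)) \<le> open_content L (G k)"
        using le_open_content[OF sG] mean_cmult[OF mean sC] by simp
      also have "\<dots> = ennreal (measure radon_measure (G k))"
        using oG by (simp add: emeasure_radon_measure radon_outer_open flip: emeasure_eq_measure)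
      finally show ?thesis using n by (simp add: field_simps)
    qed
    have "f z = (\<Sum>k<n. s k z)" for z
      using sum_lessThan_telescope[of "\<lambda>k. min (f z) (real k / n)" n] f01[of z] n
      by (simp add: s_def min_def)
    then have "L f = L (\<lambda>z. \<Sum>k<n. s k z)" by presburger
    also have "\<dots> = (\<Sum>k<n. L (s k))" by (intro mean_sum[OF mean] sC) simp
    also have "\<dots> \<le> (\<Sum>k<n. measure radon_measure (G k) / n)" by (intro sum_mono Ls)
    also have "\<dots> = (\<integral>z. (\<Sum>k<n. indicator (G k) z / n) \<partial>radon_measure)"
      by (subst Bochner_Integration.integral_sum) (auto simp: less_top[symmetric] emeasure_finite)
    also have "\<dots> \<le> (\<integral>z. f z + 1 / n \<partial>radon_measure)"
    proof (rule integral_mono)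
      show "integrable radon_measure (\<lambda>z. \<Sum>k<n. indicator (G k) z / n)"
        by (intro Bochner_Integration.integrable_sum) (auto simp: less_top[symmetric] emeasure_finite)
      \<comment> \<open>Raising \<open>f\<close> by one level makes its \<open>k\<close>-th layer
        full on \<open>G k\<close>, so the layers of \<open>f + 1 / n\<close> dominate the
        indicators and telescope.\<close>
      show "(\<Sum>k<n. indicator (G k) z / n) \<le> f z + 1 / n" for z
      proof -
        have "(indicator (G k) z :: real) / n \<le> min (f z + 1 / n) (real (Suc k) / n) - min (f z + 1 / n) (k / n)" for k
        proof (cases "z \<in> G k")
          case True
          then show ?thesis unfolding step by (simp add: G_def min_absorb2)
        next
          case False
          then show ?thesis
            unfolding step using min_step[of "1 / n" "f z + 1 / n" "k / n"] by simp
        qed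
        then have "(\<Sum>k<n. indicator (G k) z / n) \<le>
            (\<Sum>k<n. min (f z + 1 / n) (real (Suc k) / n) - min (f z + 1 / n) (k / n))"
          by (intro sum_mono)
        also have "\<dots> = min (f z + 1 / n) 1 - min (f z + 1 / n) 0"
          using sum_lessThan_telescope[of "\<lambda>k. min (f z + 1 / n) (real k / n)" n] n by simp
        also have "\<dots> \<le> f z + 1 / n" using f01[of z] n by (simp add: min_def)
        finally show ?thesis .
      qed
    qed (use fi in auto)
    also have "\<dots> = (\<integral>z. f z \<partial>radon_measure) + 1 / n"
      using fi prob_space by simp
    finally show ?thesis .
  qed
  then have le: "L f - (\<integral>z. f z \<partial>radon_measure) \<le> 1 / n" if "n > 0" for n :: nat
    using that by (simp add: le_diff_eq diff_le_eq add.commute)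
  show ?thesis
  proof (rule ccontr)
    assume "\<not> ?thesis"
    then obtain n :: nat where "n > 0" "1 / n < L f - (\<integral>z. f z \<partial>radon_measure)"
      using ex_inverse_of_nat_less[of "L f - (\<integral>z. f z \<partial>radon_measure)"] by (auto simp: inverse_eq_divide)
    then show False using le[of n] by simp
  qed
qed

text \<open>An affine change of scale maps the range into the unit interval, and the one-sided
  estimate for both \<open>f\<close> and \<open>- f\<close> gives equality.\<close>

lemma mean_eq_radon_integral:
  assumes f: "f \<in> Cb"
  shows "L f = (\<integral>z. f z \<partial>radon_measure)"
proof -
  interpret prob_space radon_measure by (rule prob_space_radon_measure)
  obtain B where B: "B > 0" "\<forall>x. \<bar>f x\<bar> \<le> B" using Cb_bound[OF f] by auto
  have fm[measurable]: "f \<in> borel_measurable borel"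
    by (rule borel_measurable_continuous_onI[OF Cb_continuous[OF f]])
  have fi: "integrable radon_measure f"
    by (rule integrable_const_bound[of _ B]) (use B in auto)
  have le: "L g \<le> (\<integral>z. g z \<partial>radon_measure)"
    if g: "g \<in> Cb" "integrable radon_measure g" "\<forall>x. \<bar>g x\<bar> \<le> B" for g
  proof -
    have B': "- B \<le> g z" "g z \<le> B" for z using g(3)[rule_format, of z] by auto
    have "L (\<lambda>z. (1 / (2 * B)) * (g z + B)) \<le> (\<integral>z. (1 / (2 * B)) * (g z + B) \<partial>radon_measure)"
    proof (rule mean_le_radon_integral_unit)
      show "(\<lambda>z. (1 / (2 * B)) * (g z + B)) \<in> Cb" by (intro Cb_cmult Cb_add Cb_const g)
      show "0 \<le> (1 / (2 * B)) * (g z + B)" "(1 / (2 * B)) * (g z + B) \<le> 1" for z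
        using B' [of z] B(1) by (auto simp: field_simps)
    qed
    moreover have "L (\<lambda>z. (1 / (2 * B)) * (g z + B)) = (1 / (2 * B)) * (L g + B)"
      using mean_cmult[OF mean Cb_add[OF g(1) Cb_const], of "1 / (2 * B)" B]
        mean_add[OF mean g(1) Cb_const, of B] mean_const[OF mean, of B] by simp
    moreover have "(\<integral>z. (1 / (2 * B)) * (g z + B) \<partial>radon_measure) = (1 / (2 * B)) * ((\<integral>z. g z \<partial>radon_measure) + B)"
      using g prob_space by simp
    ultimately show ?thesis using B(1) by (simp add: field_simps)
  qed
  have "L (\<lambda>z. - f z) = - L f" using mean_cmult[OF mean f, of "-1"] by simp
  then show ?thesis
    using le[OF f fi B(2)] le[OF Cb_uminus[OF f]] fi B by simp
qed

end

theorem tight_mean_representation: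
  fixes L :: "('a::t2_space \<Rightarrow> real) \<Rightarrow> real"
  assumes "mean_functional L" "tight_functional L" "completely_regular_space (euclidean :: 'a topology)"
  shows "\<exists>M. radon_prob M \<and> (\<forall>f\<in>Cb. L f = (\<integral>z. f z \<partial>M))"
  using radon_prob_radon_measure[OF assms] mean_eq_radon_integral[OF assms] by blast

subsection \<open>Marginals\<close>

lemma Cb_borel_measurable: "f \<in> Cb \<Longrightarrow> f \<in> borel_measurable borel"
  by (rule borel_measurable_continuous_onI[OF Cb_continuous])

lemma Cb_integrable:
  assumes "prob_space M" "sets M = sets borel" "f \<in> Cb"
  shows "integrable M f"
proof -
  interpret prob_space M by fact
  obtain B where B: "\<forall>x. \<bar>f x\<bar> \<le> B" using Cb_bound[OF assms(3)] by auto
  have "f \<in> borel_measurable M"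
    using Cb_borel_measurable[OF assms(3)] measurable_cong_sets[OF assms(2) refl] by blast
  then show ?thesis
    by (intro integrable_const_bound[of _ B]) (use B in auto)
qed

lemma mean_functional_integral:
  fixes M :: "'a::topological_space measure"
  assumes M: "prob_space M" "sets M = sets borel"
  shows "mean_functional (\<lambda>f. \<integral>z. f z \<partial>M)"
proof -
  interpret prob_space M by fact
  show ?thesis
    unfolding mean_functional_def
    using Cb_integrable[OF M] prob_space by simp
qed

lemma radon_probD:
  assumes "radon_prob M"
  shows "prob_space M" "sets M = sets borel" "space M = UNIV"
  using assms sets_eq_imp_space_eq[of M borel] by (auto simp: radon_prob_def)

section \<open>Radon probabilities are determined by integrals of continuous functions\<close>

lemma normal_separation:
  fixes F U :: "'a::topological_space set"
  assumes "normal_space (euclidean :: 'a topology)" "closed F" "open U" "F \<subseteq> U"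
  shows "\<exists>h\<in>unit_below U. \<forall>z\<in>F. h z = 1"
proof -
  have "closedin euclidean (- U)" "closedin euclidean F" "disjnt (- U) F"
    using assms by (auto simp: disjnt_def)
  then obtain f :: "'a \<Rightarrow> real" where f: "continuous_map euclidean (top_of_set {0..1}) f"
      "f ` (- U) \<subseteq> {0}" "f ` F \<subseteq> {1}"
    using Urysohn_lemma[OF assms(1), of "- U" F 0 1] by auto
  have c: "continuous_on UNIV f" and r: "\<And>z. f z \<in> {0..1}"
    using f(1) by (auto simp: continuous_map_in_subtopology)
  have "f \<in> Cb"
    by (rule CbI[of _ 1, OF c]) (use r in \<open>auto simp: abs_le_iff intro: order_trans[of _ 0]\<close>)
  then show ?thesis
    using f r by (intro bexI[of _ f]) (auto simp: unit_below_def)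
qed

text \<open>Compact sets are closed in a Hausdorff space, so the complement of a compact set that
  nearly fills \<open>- F\<close> is an open neighbourhood of \<open>F\<close> with little extra
  mass.\<close>

lemma radon_prob_outer_regular:
  fixes M :: "'a::t2_space measure"
  assumes M: "radon_prob M" and F: "closed F" and e: "e > 0"
  shows "\<exists>U. open U \<and> F \<subseteq> U \<and> measure M U < measure M F + e"
proof -
  interpret prob_space M using radon_probD(1)[OF M] .
  note sM = radon_probD(2)[OF M]
  have "- F \<in> sets borel" using F by auto
  then obtain K where K: "compact K" "K \<subseteq> - F" "measure M (- F - K) < e"
    using M e unfolding radon_prob_def by blast
  have cK: "closed K" using K(1) by (rule compact_imp_closed)
  have "measure M (- K) = measure M (F \<union> (- F - K))"
    using K(2) by (intro arg_cong[where f = "measure M"]) auto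
  also have "\<dots> = measure M F + measure M (- F - K)"
    using F cK by (intro finite_measure_Union) (auto simp: sM)
  finally show ?thesis
    using K cK by (intro exI[of _ "- K"]) auto
qed

lemma unit_below_integral_le_measure:
  assumes M: "prob_space M" "sets M = sets borel" and U: "U \<in> sets borel" and h: "h \<in> unit_below U"
  shows "(\<integral>z. h z \<partial>M) \<le> measure M U"
proof -
  interpret prob_space M by fact
  have sp: "space M = UNIV" using sets_eq_imp_space_eq[OF M(2)] by simp
  have "(\<integral>z. h z \<partial>M) \<le> (\<integral>z. indicator U z \<partial>M)"
  proof (rule integral_mono)
    show "integrable M h" using h by (intro Cb_integrable[OF M]) (simp add: unit_below_def)
    show "integrable M (indicat_real U)" using U M by (simp add: emeasure_finite less_top[symmetric])
    show "h z \<le> indicator U z" for z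
      using h by (cases "z \<in> U") (auto simp: unit_below_def)
  qed
  then show ?thesis using sp by simp
qed

lemma measure_le_integral:
  assumes M: "prob_space M" "sets M = sets borel" and F: "F \<in> sets borel"
    and h: "h \<in> Cb" "\<And>z. 0 \<le> h z" "\<And>z. z \<in> F \<Longrightarrow> 1 \<le> h z"
  shows "measure M F \<le> (\<integral>z. h z \<partial>M)"
proof -
  interpret prob_space M by fact
  have sp: "space M = UNIV" using sets_eq_imp_space_eq[OF M(2)] by simp
  have "(\<integral>z. indicator F z \<partial>M) \<le> (\<integral>z. h z \<partial>M)"
  proof (rule integral_mono)
    show "integrable M h" using h(1) by (rule Cb_integrable[OF M])
    show "integrable M (indicat_real F)" using F M by (simp add: emeasure_finite less_top[symmetric])
    show "indicator F z \<le> h z" for z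
      using h by (cases "z \<in> F") auto
  qed
  then show ?thesis using sp by simp
qed

text \<open>A Urysohn function fits between the indicator of \<open>F\<close> and that of an open
  \<open>U\<close> of nearly the same \<open>N\<close>-measure; its integral is the same for
  \<open>M\<close> and \<open>N\<close>.\<close>

lemma radon_prob_le_closed:
  fixes M N :: "'a::t2_space measure"
  assumes norm: "normal_space (euclidean :: 'a topology)"
    and M: "radon_prob M" and N: "radon_prob N"
    and eq: "\<And>f. f \<in> Cb \<Longrightarrow> (\<integral>z. f z \<partial>M) = (\<integral>z. f z \<partial>N)"
    and F: "closed F"
  shows "measure M F \<le> measure N F"
proof (rule field_le_epsilon)
  fix e :: real assume "e > 0"
  then obtain U where U: "open U" "F \<subseteq> U" "measure N U < measure N F + e"
    using radon_prob_outer_regular[OF N F] by blast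
  obtain h where h: "h \<in> unit_below U" "\<forall>z\<in>F. h z = 1"
    using normal_separation[OF norm F U(1,2)] by blast
  have hC: "h \<in> Cb" using h by (simp add: unit_below_def)
  have "measure M F \<le> (\<integral>z. h z \<partial>M)"
    using h F by (intro measure_le_integral radon_probD[OF M]) (auto simp: unit_below_def)
  also have "\<dots> = (\<integral>z. h z \<partial>N)" by (rule eq[OF hC])
  also have "\<dots> \<le> measure N U"
    using U(1) by (intro unit_below_integral_le_measure radon_probD[OF N] h) auto
  finally show "measure M F \<le> measure N F + e" using U by simp
qed

text \<open>The comparison on closed sets is applied in both directions, and the closed sets form an
  intersection-stable generator. The lemma serves to identify marginals that are known only through
  their integrals.\<close>

lemma radon_prob_eqI:
  fixes M N :: "'a::t2_space measure"
  assumes norm: "normal_space (euclidean :: 'a topology)"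
    and M: "radon_prob M" and N: "radon_prob N"
    and eq: "\<And>f. f \<in> Cb \<Longrightarrow> (\<integral>z. f z \<partial>M) = (\<integral>z. f z \<partial>N)"
  shows "M = N"
proof (rule measure_eqI_generator_eq[where E = "{S. closed S}" and \<Omega> = UNIV and A = "\<lambda>_. UNIV"])
  interpret M: prob_space M using radon_probD(1)[OF M] .
  interpret N: prob_space N using radon_probD(1)[OF N] .
  have cl: "sets borel = sigma_sets UNIV {S :: 'a set. closed S}"
  proof
    show "sigma_sets UNIV {S :: 'a set. closed S} \<subseteq> sets borel"
      by (rule sets.sigma_sets_subset'[of _ borel, simplified]) auto
    have "S \<in> sigma_sets UNIV {S :: 'a set. closed S}" if "open S" for S
      using sigma_sets.Compl[of "- S" UNIV "{S :: 'a set. closed S}"] that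
      by (auto simp: Compl_eq_Diff_UNIV[symmetric])
    then show "sets borel \<subseteq> sigma_sets UNIV {S :: 'a set. closed S}"
      unfolding sets_borel by (intro sigma_sets_mono) auto
  qed
  show "sets M = sigma_sets UNIV {S. closed S}" "sets N = sigma_sets UNIV {S. closed S}"
    using radon_probD[OF M] radon_probD[OF N] cl by auto
  show "emeasure M X = emeasure N X" if "X \<in> {S. closed S}" for X
    using that radon_prob_le_closed[OF norm M N eq, of X] radon_prob_le_closed[OF norm N M eq[symmetric], of X]
    by (simp add: M.emeasure_eq_measure N.emeasure_eq_measure)
  show "Int_stable {S. closed S}" by (auto simp: Int_stable_def)
  show "emeasure M UNIV \<noteq> \<infinity>" by (simp add: M.emeasure_finite)
qed auto

lemma radon_prob_distr:
  fixes f :: "'a::t2_space \<Rightarrow> 'b::t2_space"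
  assumes M: "radon_prob M" and f: "continuous_on UNIV f"
  shows "radon_prob (distr M borel f)"
  unfolding radon_prob_def
proof (intro conjI ballI allI impI)
  interpret prob_space M using radon_probD(1)[OF M] .
  have fm: "f \<in> measurable M borel"
    using borel_measurable_continuous_onI[OF f] measurable_cong_sets[OF radon_probD(2)[OF M] refl] by blast
  show "prob_space (distr M borel f)" by (rule prob_space_distr[OF fm])
  fix B :: "'b set" and e :: real assume B: "B \<in> sets borel" and e: "e > 0"
  have "f -` B \<in> sets borel"
    using measurable_sets[OF borel_measurable_continuous_onI[OF f] B] by simp
  then obtain K where K: "compact K" "K \<subseteq> f -` B" "measure M (f -` B - K) < e"
    using M e unfolding radon_prob_def by blast
  have fK: "compact (f ` K)"
    using K(1) f by (auto intro: compact_continuous_image continuous_on_subset)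
  have BK: "B - f ` K \<in> sets borel"
    using B fK by (auto intro: borel_compact)
  have "measure (distr M borel f) (B - f ` K) = measure M (f -` (B - f ` K))"
    using BK radon_probD[OF M] by (simp add: measure_distr[OF fm])
  also have "\<dots> \<le> measure M (f -` B - K)"
    using \<open>f -` B \<in> sets borel\<close> K(1) radon_probD[OF M]
    by (intro finite_measure_mono) (auto intro: borel_compact)
  finally show "\<exists>K. compact K \<and> K \<subseteq> B \<and> measure (distr M borel f) (B - K) < e"
    using K fK by (intro exI[of _ "f ` K"]) auto
qed simp

text \<open>A compact rectangle carrying most of both marginals carries most of \<open>L\<close>: by the tube lemma a
  function that vanishes on the rectangle is small on a product neighbourhood of it, and off that
  neighbourhood it is dominated by a sum \<open>\<phi> x + \<psi> y\<close> of Urysohn functions with small integrals.\<close>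
lemma tight_functional_of_marginals:
  fixes \<mu> :: "'a::t2_space measure" and \<nu> :: "'b::t2_space measure"
  assumes nX: "normal_space (euclidean :: 'a topology)" and nY: "normal_space (euclidean :: 'b topology)"
    and \<mu>: "radon_prob \<mu>" and \<nu>: "radon_prob \<nu>"
    and L: "mean_functional L"
    and marg: "\<And>\<phi> \<psi>. \<phi> \<in> Cb \<Longrightarrow> \<psi> \<in> Cb \<Longrightarrow>
      L (\<lambda>(x, y). \<phi> x + \<psi> y) = (\<integral>x. \<phi> x \<partial>\<mu>) + (\<integral>y. \<psi> y \<partial>\<nu>)"
  shows "tight_functional L"
  unfolding tight_functional_def
proof (intro allI impI)
  fix e :: real assume e: "e > 0"
  \<comment> \<open>\<open>K\<close> is fixed before \<open>U\<close>: tightness asks for one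
    compact set for all \<open>f\<close>, whereas the product neighbourhood of the rectangle depends
    on \<open>f\<close>.\<close>
  have small: "\<exists>K. compact K \<and> (\<forall>U. open U \<longrightarrow> K \<subseteq> U \<longrightarrow>
      (\<exists>\<phi>\<in>Cb. (\<forall>z. 0 \<le> \<phi> z) \<and> (\<forall>z. z \<notin> U \<longrightarrow> 1 \<le> \<phi> z) \<and> (\<integral>z. \<phi> z \<partial>M) \<le> e / 3))"
    if norm: "normal_space (euclidean :: 'c topology)" and M: "radon_prob M" for M :: "'c::t2_space measure"
  proof -
    obtain K where K: "compact K" "measure M (UNIV - K) < e / 3"
      using M e unfolding radon_prob_def
      by (metis divide_pos_pos zero_less_numeral space_in_borel)
    have cK: "closed K" using K(1) by (rule compact_imp_closed)
    have "\<exists>\<phi>\<in>Cb. (\<forall>z. 0 \<le> \<phi> z) \<and> (\<forall>z. z \<notin> U \<longrightarrow> 1 \<le> \<phi> z) \<and> (\<integral>z. \<phi> z \<partial>M) \<le> e / 3"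
      if U: "open U" "K \<subseteq> U" for U
    proof -
      obtain h where h: "h \<in> unit_below U" "\<forall>z\<in>K. h z = 1"
        using normal_separation[OF norm cK U] by blast
      have below: "(\<lambda>z. 1 - h z) \<in> unit_below (- K)"
        using h by (auto simp: unit_below_def intro!: Cb_diff Cb_const)
      have "(\<integral>z. 1 - h z \<partial>M) \<le> measure M (- K)"
        using cK by (intro unit_below_integral_le_measure radon_probD[OF M] below) auto
      then have "(\<integral>z. 1 - h z \<partial>M) \<le> e / 3"
        using K(2) by (simp add: Compl_eq_Diff_UNIV)
      then show ?thesis
        using h below by (intro bexI[of _ "\<lambda>z. 1 - h z"]) (auto simp: unit_below_def)
    qed
    then show ?thesis using K(1) by blast
  qed
  obtain K where K: "compact K" and KU: "\<And>U. open U \<Longrightarrow> K \<subseteq> U \<Longrightarrow>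
      \<exists>\<phi>\<in>Cb. (\<forall>z. 0 \<le> \<phi> z) \<and> (\<forall>z. z \<notin> U \<longrightarrow> 1 \<le> \<phi> z) \<and> (\<integral>z. \<phi> z \<partial>\<mu>) \<le> e / 3"
    using small[OF nX \<mu>] by blast
  obtain K' where K': "compact K'" and KU': "\<And>U. open U \<Longrightarrow> K' \<subseteq> U \<Longrightarrow>
      \<exists>\<phi>\<in>Cb. (\<forall>z. 0 \<le> \<phi> z) \<and> (\<forall>z. z \<notin> U \<longrightarrow> 1 \<le> \<phi> z) \<and> (\<integral>z. \<phi> z \<partial>\<nu>) \<le> e / 3"
    using small[OF nY \<nu>] by blast
  have "L f \<le> e" if f: "f \<in> unit_below (- (K \<times> K'))" for f
  proof -
    have fC: "f \<in> Cb" and f01: "f z \<le> 1" and f0: "z \<in> K \<times> K' \<Longrightarrow> f z = 0" for z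
      using f by (simp_all add: unit_below_def del: split_paired_All)
    \<comment> \<open>The three thirds of \<open>e\<close> are the bound for \<open>f\<close> near
      the rectangle and the integrals of \<open>\<phi>\<close> and \<open>\<psi>\<close>.\<close>
    define W where "W = {z. f z < e / 3}"
    have "open W" unfolding W_def
      by (intro open_Collect_less continuous_on_const Cb_continuous fC)
    then have "openin (prod_topology euclidean euclidean) W" by simp
    moreover have "K \<times> K' \<subseteq> W" using f0 e by (auto simp: W_def)
    ultimately obtain U V where UV: "open U" "open V" "K \<subseteq> U" "K' \<subseteq> V" "U \<times> V \<subseteq> W"
      using Wallace_theorem_prod_topology[of euclidean K euclidean K' W] K K' by auto
    obtain \<phi> where \<phi>: "\<phi> \<in> Cb" "\<And>z. 0 \<le> \<phi> z" "\<And>z. z \<notin> U \<Longrightarrow> 1 \<le> \<phi> z" "(\<integral>z. \<phi> z \<partial>\<mu>) \<le> e / 3"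
      using KU[OF UV(1,3)] by auto
    obtain \<psi> where \<psi>: "\<psi> \<in> Cb" "\<And>z. 0 \<le> \<psi> z" "\<And>z. z \<notin> V \<Longrightarrow> 1 \<le> \<psi> z" "(\<integral>z. \<psi> z \<partial>\<nu>) \<le> e / 3"
      using KU'[OF UV(2,4)] by auto
    define s where "s = (\<lambda>(x, y). \<phi> x + \<psi> y)"
    have sC: "s \<in> Cb"
      unfolding s_def case_prod_unfold
      by (intro Cb_add Cb_compose[OF \<phi>(1)] Cb_compose[OF \<psi>(1)] continuous_intros)
    have "L f \<le> L (\<lambda>z. s z + e / 3)"
    proof (rule mean_mono[OF L fC])
      show "(\<lambda>z. s z + e / 3) \<in> Cb" by (intro Cb_add sC Cb_const)
      show "f z \<le> s z + e / 3" for z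
      proof (cases "z \<in> U \<times> V")
        case True
        then have "f z < e / 3" using UV(5) by (auto simp: W_def)
        then show ?thesis using \<phi>(2)[of "fst z"] \<psi>(2)[of "snd z"] by (simp add: s_def case_prod_unfold)
      next
        case False
        then have "1 \<le> \<phi> (fst z) \<or> 1 \<le> \<psi> (snd z)" using \<phi>(3) \<psi>(3) by (cases z) auto
        then show ?thesis
          using \<phi>(2)[of "fst z"] \<psi>(2)[of "snd z"] f01[of z] e by (auto simp: s_def case_prod_unfold)
      qed
    qed
    also have "\<dots> = (\<integral>z. \<phi> z \<partial>\<mu>) + (\<integral>z. \<psi> z \<partial>\<nu>) + e / 3"
      using mean_add[OF L sC Cb_const, of "e / 3"] mean_const[OF L, of "e / 3"] marg[OF \<phi>(1) \<psi>(1)]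
      by (simp add: s_def)
    also have "\<dots> \<le> e" using \<phi>(4) \<psi>(4) by simp
    finally show ?thesis .
  qed
  then show "\<exists>K. compact K \<and> (\<forall>f\<in>unit_below (- K). L f \<le> e)"
    using compact_Times[OF K K'] by blast
qed

lemma Hausdorff_space_t2: "Hausdorff_space (euclidean :: 'a::t2_space topology)"
  unfolding Hausdorff_space_def disjnt_def using hausdorff[where 'a = 'a] by auto

text \<open>Hausdorffness lets normality of each factor imply complete regularity, which passes to
  products.\<close>

lemma completely_regular_prod:
  assumes "normal_space (euclidean :: 'a::t2_space topology)" "normal_space (euclidean :: 'b::t2_space topology)"
  shows "completely_regular_space (euclidean :: ('a \<times> 'b) topology)"
  unfolding prod_topology_euclidean[symmetric] completely_regular_space_prod_topology
  using normal_imp_completely_regular_space[OF assms(1)] normal_imp_completely_regular_space[OF assms(2)]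
  by (simp add: Hausdorff_space_t2)

lemma integral_marginal:
  assumes \<pi>: "radon_prob \<pi>" and p: "continuous_on UNIV p" and \<phi>: "\<phi> \<in> Cb"
  shows "(\<integral>x. \<phi> x \<partial>distr \<pi> borel p) = (\<integral>z. \<phi> (p z) \<partial>\<pi>)"
proof (rule integral_distr)
  show "p \<in> measurable \<pi> borel"
    using borel_measurable_continuous_onI[OF p] measurable_cong_sets[OF radon_probD(2)[OF \<pi>] refl] by blast
qed (rule Cb_borel_measurable[OF \<phi>])

text \<open>The representing measure reproduces integrals; setting one of the two test functions to
  zero isolates each marginal, and uniqueness on the normal factors upgrades equal integrals to
  equal measures.\<close>

theorem mean_with_marginals_representation:
  fixes \<mu> :: "'a::t2_space measure" and \<nu> :: "'b::t2_space measure"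
  assumes nX: "normal_space (euclidean :: 'a topology)" and nY: "normal_space (euclidean :: 'b topology)"
    and \<mu>: "radon_prob \<mu>" and \<nu>: "radon_prob \<nu>"
    and L: "mean_functional L"
    and marg: "\<And>\<phi> \<psi>. \<phi> \<in> Cb \<Longrightarrow> \<psi> \<in> Cb \<Longrightarrow>
      L (\<lambda>(x, y). \<phi> x + \<psi> y) = (\<integral>x. \<phi> x \<partial>\<mu>) + (\<integral>y. \<psi> y \<partial>\<nu>)"
  shows "\<exists>\<pi>\<in>Pi_cpl \<mu> \<nu>. \<forall>f\<in>Cb. L f = (\<integral>z. f z \<partial>\<pi>)"
proof -
  obtain \<pi> where \<pi>: "radon_prob \<pi>" and L\<pi>: "\<And>f. f \<in> Cb \<Longrightarrow> L f = (\<integral>z. f z \<partial>\<pi>)"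
    using tight_mean_representation[OF L tight_functional_of_marginals[OF nX nY \<mu> \<nu> L marg]
        completely_regular_prod[OF nX nY]] by blast
  have cf: "continuous_on UNIV (fst :: 'a \<times> 'b \<Rightarrow> 'a)" and cs: "continuous_on UNIV (snd :: 'a \<times> 'b \<Rightarrow> 'b)"
    by (intro continuous_intros)+
  have "distr \<pi> borel fst = \<mu>"
  proof (rule radon_prob_eqI[OF nX radon_prob_distr[OF \<pi> cf] \<mu>])
    fix \<phi> :: "'a \<Rightarrow> real" assume \<phi>: "\<phi> \<in> Cb"
    show "(\<integral>x. \<phi> x \<partial>distr \<pi> borel fst) = (\<integral>x. \<phi> x \<partial>\<mu>)"
      using marg[OF \<phi> Cb_const[of 0]] L\<pi>[OF Cb_compose[OF \<phi> cf]] integral_marginal[OF \<pi> cf \<phi>]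
      by (simp add: case_prod_unfold)
  qed
  moreover have "distr \<pi> borel snd = \<nu>"
  proof (rule radon_prob_eqI[OF nY radon_prob_distr[OF \<pi> cs] \<nu>])
    fix \<psi> :: "'b \<Rightarrow> real" assume \<psi>: "\<psi> \<in> Cb"
    show "(\<integral>x. \<psi> x \<partial>distr \<pi> borel snd) = (\<integral>x. \<psi> x \<partial>\<nu>)"
      using marg[OF Cb_const[of 0] \<psi>] L\<pi>[OF Cb_compose[OF \<psi> cs]] integral_marginal[OF \<pi> cs \<psi>]
      by (simp add: case_prod_unfold)
  qed
  ultimately have "\<pi> \<in> Pi_cpl \<mu> \<nu>" using \<pi> by (simp add: Pi_cpl_def)
  then show ?thesis using L\<pi> by blast
qed

lemma integral_Pi_cpl:
  fixes \<mu> :: "'a::t2_space measure" and \<nu> :: "'b::t2_space measure"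
  assumes \<pi>: "\<pi> \<in> Pi_cpl \<mu> \<nu>" and \<phi>: "\<phi> \<in> Cb" and \<psi>: "\<psi> \<in> Cb"
  shows "(\<integral>z. (case z of (x, y) \<Rightarrow> \<phi> x + \<psi> y) \<partial>\<pi>) = (\<integral>x. \<phi> x \<partial>\<mu>) + (\<integral>y. \<psi> y \<partial>\<nu>)"
proof -
  have r: "radon_prob \<pi>" and m: "\<mu> = distr \<pi> borel fst" "\<nu> = distr \<pi> borel snd"
    using \<pi> by (auto simp: Pi_cpl_def)
  have cf: "continuous_on UNIV (fst :: 'a \<times> 'b \<Rightarrow> 'a)" and cs: "continuous_on UNIV (snd :: 'a \<times> 'b \<Rightarrow> 'b)"
    by (intro continuous_intros)+
  show ?thesis
    unfolding m integral_marginal[OF r cf \<phi>] integral_marginal[OF r cs \<psi>] case_prod_unfold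
    by (rule Bochner_Integration.integral_add)
       (rule Cb_integrable[OF radon_probD(1,2)[OF r]], rule Cb_compose[OF \<phi> cf] Cb_compose[OF \<psi> cs])+
qed

subsection \<open>Restriction of measures to the zero-set algebra\<close>

lemma zero_sets_closed: "F \<in> zero_sets \<Longrightarrow> closed F"
  unfolding zero_sets_def by (auto intro: closed_vimage)

lemma zero_algebra_subset_borel: "zero_algebra \<subseteq> sets (borel :: 'a::topological_space measure)"
proof (rule zero_algebra_minimal)
  show "algebra UNIV (sets (borel :: 'a measure))"
    using sets.algebra_axioms[of "borel :: 'a measure"] by simp
qed (auto intro: borel_closed zero_sets_closed)

lemma zero_sets_Un:
  fixes F G :: "'a::topological_space set"
  shows "F \<in> zero_sets \<Longrightarrow> G \<in> zero_sets \<Longrightarrow> F \<union> G \<in> zero_sets"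
  unfolding zero_sets_def
proof clarify
  fix f g :: "'a \<Rightarrow> real" assume "continuous_on UNIV f" "continuous_on UNIV g"
  then show "\<exists>h :: 'a \<Rightarrow> real. continuous_on UNIV h \<and> f -` {0} \<union> g -` {0} = h -` {0}"
    by (auto intro!: exI[of _ "\<lambda>z. f z * g z"] continuous_on_mult)
qed

lemma zero_sets_Int:
  fixes F G :: "'a::topological_space set"
  shows "F \<in> zero_sets \<Longrightarrow> G \<in> zero_sets \<Longrightarrow> F \<inter> G \<in> zero_sets"
  unfolding zero_sets_def
proof clarify
  fix f g :: "'a \<Rightarrow> real" assume "continuous_on UNIV f" "continuous_on UNIV g"
  then show "\<exists>h :: 'a \<Rightarrow> real. continuous_on UNIV h \<and> f -` {0} \<inter> g -` {0} = h -` {0}"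
    by (auto intro!: exI[of _ "\<lambda>z. \<bar>f z\<bar> + \<bar>g z\<bar>"] continuous_intros)
qed

text \<open>The sets that, together with their complements, are approximable from inside by zero-sets form
  an algebra; a cozero-set \<open>{f \<noteq> 0}\<close> is exhausted by the zero-sets \<open>{\<bar>f\<bar> \<ge> 1/n}\<close>.\<close>
lemma zero_algebra_inner_regular:
  fixes M :: "'a::topological_space measure"
  assumes M: "prob_space M" "sets M = sets borel"
    and A: "A \<in> zero_algebra" and e: "e > 0"
  shows "\<exists>F\<in>zero_sets. F \<subseteq> A \<and> measure M (A - F) < e"
proof -
  interpret prob_space M by fact
  define inner where "inner A \<longleftrightarrow> (\<forall>e>0. \<exists>F\<in>zero_sets. F \<subseteq> A \<and> measure M (A - F) < e)" for A
  define R where "R = {A \<in> sets M. inner A \<and> inner (- A)}"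
  have zs: "F \<in> sets M" if "F \<in> zero_sets" for F
    using borel_closed[OF zero_sets_closed[OF that]] M(2) by simp
  have zero: "{} \<in> (zero_sets :: 'a set set)"
    unfolding zero_sets_def by (auto intro!: exI[of _ "\<lambda>_. 1"])
  have univ: "UNIV \<in> (zero_sets :: 'a set set)"
    unfolding zero_sets_def by (auto intro!: exI[of _ "\<lambda>_. 0"])
  have inner_zero: "inner F" if "F \<in> zero_sets" for F
    using that unfolding inner_def by (auto intro!: bexI[of _ F])
  have small_Un: "measure M C < e"
    if "C \<subseteq> A' \<union> B'" "measure M A' < e / 2" "measure M B' < e / 2" "A' \<in> sets M" "B' \<in> sets M" for C A' B' e
  proof -
    have "measure M C \<le> measure M (A' \<union> B')" using that by (intro finite_measure_mono) auto
    also have "\<dots> \<le> measure M A' + measure M B'" using that by (intro measure_Un_le) auto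
    finally show ?thesis using that by simp
  qed
  \<comment> \<open>Closure of \<open>R\<close> under unions needs both operations, as the
    complement of a union is an intersection of complements.\<close>
  have inner2: "inner (A \<union> B) \<and> inner (A \<inter> B)" if AB: "inner A" "inner B" "A \<in> sets M" "B \<in> sets M" for A B
    unfolding inner_def
  proof (intro conjI allI impI)
    fix e :: real assume "e > 0"
    then obtain F G where F: "F \<in> zero_sets" "F \<subseteq> A" "measure M (A - F) < e / 2"
        and G: "G \<in> zero_sets" "G \<subseteq> B" "measure M (B - G) < e / 2"
      using AB(1,2) unfolding inner_def by (meson half_gt_zero)
    have s: "A - F \<in> sets M" "B - G \<in> sets M" using zs F G AB by auto
    have "measure M (A \<union> B - (F \<union> G)) < e" "measure M (A \<inter> B - F \<inter> G) < e"
      by (rule small_Un[OF _ F(3) G(3) s], blast)+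
    then show "\<exists>H\<in>zero_sets. H \<subseteq> A \<union> B \<and> measure M (A \<union> B - H) < e"
      "\<exists>H\<in>zero_sets. H \<subseteq> A \<inter> B \<and> measure M (A \<inter> B - H) < e"
      using F G zero_sets_Un zero_sets_Int by (metis Un_mono, metis Int_mono)
  qed
  have "zero_algebra \<subseteq> R"
  proof (rule zero_algebra_minimal)
    show "algebra UNIV R"
      unfolding algebra_iff_Un
    proof (intro conjI ballI)
      show "{} \<in> R" using inner_zero[OF zero] inner_zero[OF univ] by (simp add: R_def)
      show "UNIV - A \<in> R" if "A \<in> R" for A
        using that sets.compl_sets[of A M] sets_eq_imp_space_eq[OF M(2)]
        by (auto simp: R_def Compl_eq_Diff_UNIV[symmetric])
      show "A \<union> B \<in> R" if "A \<in> R" "B \<in> R" for A B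
      proof -
        have c: "- A \<in> sets M" "- B \<in> sets M"
          using that M(2) by (auto simp: R_def borel_comp)
        show ?thesis
          using that inner2[of A B] inner2[of "- A" "- B"] c by (auto simp: R_def)
      qed
    qed simp
    show "zero_sets \<subseteq> R"
    proof
      fix Z :: "'a set" assume Z: "Z \<in> zero_sets"
      then obtain f :: "'a \<Rightarrow> real" where f: "continuous_on UNIV f" "Z = f -` {0}"
        unfolding zero_sets_def by blast
      define F where "F n = {z. 1 / real (Suc n) \<le> \<bar>f z\<bar>}" for n
      have F: "F n \<in> zero_sets" for n
        unfolding F_def by (intro zero_sets_ge continuous_on_rabs f)
      have U: "(\<Union>n. F n) = - Z"
      proof -
        have "\<exists>n. z \<in> F n" if "z \<notin> Z" for z
        proof -
          have "0 < \<bar>f z\<bar>" using that f(2) by simp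
          then obtain n where "inverse (real (Suc n)) < \<bar>f z\<bar>" using reals_Archimedean by blast
          then show ?thesis by (intro exI[of _ n]) (simp add: F_def inverse_eq_divide less_imp_le)
        qed
        then show ?thesis using f(2) by (auto simp: F_def)
      qed
      have inc: "incseq F"
      proof (rule incseq_SucI)
        fix n
        have "1 / real (Suc (Suc n)) \<le> 1 / real (Suc n)" by (intro divide_left_mono) auto
        then show "F n \<subseteq> F (Suc n)" unfolding F_def by (auto intro: order_trans)
      qed
      \<comment> \<open>Here the countable additivity of \<open>M\<close> enters, as continuity from
        below.\<close>
      have "(\<lambda>n. measure M (F n)) \<longlonglongrightarrow> measure M (- Z)"
        unfolding U[symmetric] using zs F inc by (intro finite_Lim_measure_incseq) auto
      have "inner (- Z)"
        unfolding inner_def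
      proof (intro allI impI)
        fix e :: real assume "e > 0"
        then have "eventually (\<lambda>n. measure M (- Z) - e < measure M (F n)) sequentially"
          by (intro order_tendstoD(1)[OF \<open>_ \<longlonglongrightarrow> measure M (- Z)\<close>]) simp
        then obtain n where "measure M (- Z) - e < measure M (F n)"
          by (auto simp: eventually_sequentially)
        moreover have sub: "F n \<subseteq> - Z" using U by auto
        moreover have "- Z \<in> sets M" using zs[OF Z] M(2) by (simp add: borel_comp)
        ultimately have "measure M (- Z - F n) < e"
          using finite_measure_Diff[of "- Z" "F n"] zs[OF F] by simp
        then show "\<exists>F\<in>zero_sets. F \<subseteq> - Z \<and> measure M (- Z - F) < e"
          using F sub by blast
      qed
      then show "Z \<in> R" using inner_zero[OF Z] zs[OF Z] by (simp add: R_def)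
    qed
  qed
  then show ?thesis using A e by (auto simp: R_def inner_def)
qed

text \<open>The value 0 outside the algebra is a mere default, as \<open>fa_prob\<close> constrains
  only sets of the algebra.\<close>

definition zero_restriction :: "'a::topological_space measure \<Rightarrow> 'a set \<Rightarrow> real" where
  "zero_restriction M = (\<lambda>A. if A \<in> zero_algebra then measure M A else 0)"

context
  fixes M :: "'a::topological_space measure"
  assumes M: "prob_space M" "sets M = sets borel"
begin

lemma fa_prob_zero_restriction: "fa_prob (zero_restriction M)"
proof -
  interpret prob_space M by (rule M)
  have zs: "A \<in> sets M" if "A \<in> zero_algebra" for A
    using that zero_algebra_subset_borel M(2) by auto
  show ?thesis
    unfolding fa_prob_def
  proof (intro conjI ballI impI allI)
    show "zero_restriction M UNIV = 1"
      using prob_space sets_eq_imp_space_eq[OF M(2)] zero_algebra.top by (simp add: zero_restriction_def)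
    show "zero_restriction M (A \<union> B) = zero_restriction M A + zero_restriction M B"
      if "A \<in> zero_algebra" "B \<in> zero_algebra" "A \<inter> B = {}" for A B
      using that zs by (simp add: zero_restriction_def finite_measure_Union zero_algebra.Un)
    show "\<exists>F\<in>zero_sets. F \<subseteq> A \<and> zero_restriction M (A - F) < e"
      if Ae: "A \<in> zero_algebra" "e > 0" for A e
    proof -
      obtain F where F: "F \<in> zero_sets" "F \<subseteq> A" "measure M (A - F) < e"
        using zero_algebra_inner_regular[OF M Ae] by blast
      then have "A - F \<in> zero_algebra"
        using Ae(1) zero_sets_subset_zero_algebra by (intro zero_algebra.Diff) auto
      then show ?thesis using F by (auto simp: zero_restriction_def)
    qed
  qed (simp add: zero_restriction_def)
qed

text \<open>Each lower sum is the \<open>M\<close>-integral of a step function below the integrand,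
  which gives one inequality; the other is the same inequality for \<open>- f\<close>.\<close>

lemma fa_integral_zero_restriction:
  assumes f: "f \<in> Cb"
  shows "fa_integral (zero_restriction M) f = (\<integral>z. f z \<partial>M)"
proof -
  interpret prob_space M by (rule M)
  have le: "fa_integral (zero_restriction M) g \<le> (\<integral>z. g z \<partial>M)" if g: "g \<in> Cb" for g
  proof -
    obtain B where B: "\<forall>x. \<bar>g x\<bar> \<le> B" using Cb_bound[OF g] by auto
    show ?thesis
    proof (rule fa_integral_le[OF fa_prob_zero_restriction])
      show "- B \<le> g x" for x using B[rule_format, of x] by simp
      fix n A c assume P: "zero_partition {..<n::nat} A" and c: "\<And>i x. i < n \<Longrightarrow> x \<in> A i \<Longrightarrow> c i \<le> g x"
      have A: "A i \<in> sets M" "zero_restriction M (A i) = measure M (A i)" if "i < n" for i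
        using that P zero_algebra_subset_borel M(2) by (auto simp: zero_partition_def zero_restriction_def)
      have one: "(\<Sum>i<n. indicator (A i) z) = (1::real)" for z
      proof -
        have "(\<Sum>i<n. indicator (A i) z) = (indicator (\<Union>i<n. A i) z :: real)"
          using P by (intro indicator_UN_disjoint[symmetric]) (auto simp: zero_partition_def)
        then show ?thesis using P by (simp add: zero_partition_def)
      qed
      have "(\<Sum>i<n. c i * zero_restriction M (A i)) = (\<Sum>i<n. \<integral>z. c i * indicator (A i) z \<partial>M)"
        using A sets_eq_imp_space_eq[OF M(2)] by (intro sum.cong) auto
      also have "\<dots> = (\<integral>z. (\<Sum>i<n. c i * indicator (A i) z) \<partial>M)"
        using A by (intro Bochner_Integration.integral_sum[symmetric])
          (auto simp: emeasure_finite less_top[symmetric])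
      also have "\<dots> \<le> (\<integral>z. g z \<partial>M)"
      proof (rule integral_mono[OF _ Cb_integrable[OF M g]])
        show "integrable M (\<lambda>z. \<Sum>i<n. c i * indicator (A i) z)"
          using A by (intro Bochner_Integration.integrable_sum)
            (auto simp: emeasure_finite less_top[symmetric])
        show "(\<Sum>i<n. c i * indicator (A i) z) \<le> g z" for z
        proof -
          have "c i * indicator (A i) z \<le> g z * indicator (A i) z" if "i < n" for i
            using c[OF that, of z] by (cases "z \<in> A i") auto
          then have "(\<Sum>i<n. c i * indicator (A i) z) \<le> (\<Sum>i<n. g z * indicator (A i) z)"
            by (intro sum_mono) auto
          then show ?thesis by (simp only: one mult_1_right flip: sum_distrib_left)
        qed
      qed
      finally show "(\<Sum>i<n. c i * zero_restriction M (A i)) \<le> (\<integral>z. g z \<partial>M)" .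
    qed
  qed
  show ?thesis
    using le[OF f] le[OF Cb_uminus[OF f]] fa_integral_uminus[OF fa_prob_zero_restriction f] by simp
qed

end

lemma zero_restriction_in_Gamma:
  fixes \<mu> :: "'a::t2_space measure" and \<nu> :: "'b::t2_space measure"
  assumes \<pi>: "\<pi> \<in> Pi_cpl \<mu> \<nu>"
  shows "zero_restriction \<pi> \<in> Gamma \<mu> \<nu>"
  unfolding Gamma_def
proof (intro CollectI conjI ballI)
  have r: "radon_prob \<pi>" using \<pi> by (simp add: Pi_cpl_def)
  note M = radon_probD(1,2)[OF r]
  show "fa_prob (zero_restriction \<pi>)" by (rule fa_prob_zero_restriction[OF M])
  fix \<phi> :: "'a \<Rightarrow> real" and \<psi> :: "'b \<Rightarrow> real" assume \<phi>: "\<phi> \<in> Cb" and \<psi>: "\<psi> \<in> Cb"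
  have "(\<lambda>(x, y). \<phi> x + \<psi> y) \<in> Cb"
    unfolding case_prod_unfold
    by (intro Cb_add Cb_compose[OF \<phi>] Cb_compose[OF \<psi>] continuous_intros)
  then show "fa_integral (zero_restriction \<pi>) (\<lambda>(x, y). \<phi> x + \<psi> y) = (\<integral>x. \<phi> x \<partial>\<mu>) + (\<integral>y. \<psi> y \<partial>\<nu>)"
    using integral_Pi_cpl[OF \<pi> \<phi> \<psi>] by (simp add: fa_integral_zero_restriction[OF M])
qed

subsection \<open>Lower semicontinuous costs\<close>

text \<open>Stands in for the Urysohn lemma on the product: separation of points is spread over
  \<open>K\<close> by a finite subcover.\<close>

lemma completely_regular_compact_separation:
  fixes K U :: "'a::topological_space set"
  assumes CR: "completely_regular_space (euclidean :: 'a topology)"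
    and K: "compact K" and U: "open U" "K \<subseteq> U"
  shows "\<exists>h\<in>unit_below U. \<forall>z\<in>K. h z = 1"
proof -
  have "\<exists>h. x \<in> K \<longrightarrow> h \<in> unit_below U \<and> h x = 1" for x
    using completely_regular_separation[OF CR U(1), of x] U(2) by blast
  then obtain h where h: "\<And>x. x \<in> K \<Longrightarrow> h x \<in> unit_below U" "\<And>x. x \<in> K \<Longrightarrow> h x x = 1"
    by metis
  have hC: "h x \<in> Cb" and h01: "0 \<le> h x z" and h0: "z \<notin> U \<Longrightarrow> h x z = 0" if "x \<in> K" for x z
    using h(1)[OF that] by (auto simp: unit_below_def)
  have op: "open {z. 1 / 2 < h x z}" if "x \<in> K" for x
    by (intro open_Collect_less continuous_on_const Cb_continuous hC that)
  have cov: "K \<subseteq> (\<Union>x\<in>K. {z. 1 / 2 < h x z})"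
  proof
    fix x assume "x \<in> K"
    then show "x \<in> (\<Union>x\<in>K. {z. 1 / 2 < h x z})" by (intro UN_I[of x]) (simp_all add: h(2))
  qed
  obtain T where T: "T \<subseteq> K" "finite T" "K \<subseteq> (\<Union>x\<in>T. {z. 1 / 2 < h x z})"
    by (rule compactE_image[OF K op cov])
  \<comment> \<open>The factor 2 compensates for the level 1/2 of the cover, so the minimum equals 1
    on all of \<open>K\<close>.\<close>
  define s where "s z = min 1 (2 * (\<Sum>x\<in>T. h x z))" for z
  have "s \<in> Cb"
    unfolding s_def using T hC by (intro Cb_min Cb_const Cb_cmult Cb_sum) auto
  moreover have "0 \<le> s z" for z
    unfolding s_def using T h01 by (auto intro!: sum_nonneg)
  moreover have "s z = 0" if "z \<notin> U" for z
  proof -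
    have "(\<Sum>x\<in>T. h x z) = 0" using T h0[OF _ that] by (intro sum.neutral) auto
    then show ?thesis by (simp add: s_def)
  qed
  moreover have "s z \<le> 1" for z by (simp add: s_def)
  moreover have "s z = 1" if z: "z \<in> K" for z
  proof -
    obtain x where x: "x \<in> T" "1 / 2 < h x z" using z T(3) by auto
    have "h x z \<le> (\<Sum>x\<in>T. h x z)"
      by (rule member_le_sum) (use x T h01 in auto)
    then show ?thesis using x by (simp add: s_def min_def)
  qed
  ultimately show ?thesis by (intro bexI[of _ s]) (auto simp: unit_below_def)
qed

text \<open>A simple function below \<open>g\<close> is, up to small measure, supported on finitely many compact sets \<open>K y\<close>,
  and on \<open>K y\<close> the value \<open>y - d\<close> is strictly below \<open>g\<close>, hence so on a neighbourhood.\<close>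
lemma radon_nn_integral_lsc:
  fixes M :: "'a::t2_space measure" and g :: "'a \<Rightarrow> ennreal"
  assumes CR: "completely_regular_space (euclidean :: 'a topology)"
    and M: "radon_prob M" and g: "\<And>t. open {z. t < g z}"
  shows "(\<integral>\<^sup>+z. g z \<partial>M) \<le> (SUP h\<in>{h \<in> Cb. \<forall>z. 0 \<le> h z \<and> ennreal (h z) \<le> g z}. ennreal (\<integral>z. h z \<partial>M))"
    (is "_ \<le> ?S")
  unfolding nn_integral_def_finite
proof (rule SUP_least, clarify)
  note P = radon_probD[OF M]
  interpret prob_space M by (rule P)
  fix s assume s: "simple_function M s" "s \<le> g" and fin: "\<forall>x. s x < top"
  define Y where "Y = range s"
  have Y: "finite Y" using s(1) P(3) by (simp add: Y_def simple_function_def)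
  have sY: "s z \<in> Y" for z by (simp add: Y_def)
  obtain B where B: "B > 0" "\<And>y. y \<in> Y \<Longrightarrow> enn2real y \<le> B"
  proof
    show "enn2real y \<le> (\<Sum>y\<in>Y. enn2real y) + 1" if "y \<in> Y" for y
      using member_le_sum[of y Y enn2real] that Y by simp
    show "(\<Sum>y\<in>Y. enn2real y) + 1 > 0" by (intro add_nonneg_pos sum_nonneg) auto
  qed
  have N: "real (card Y) > 0" using Y by (simp add: Y_def card_gt_0_iff)
  show "integral\<^sup>S M s \<le> ?S"
  proof (rule ennreal_le_epsilon)
    fix e :: real assume e: "e > 0"
    define d where "d = e / 2"
    have d: "d > 0" using e by (simp add: d_def)
    \<comment> \<open>There are \<open>card Y\<close> exceptional sets, so their union has mass at
      most \<open>d / B\<close>; since \<open>s\<close> is bounded by \<open>B\<close>, it costs at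
      most \<open>d\<close>. The other half of \<open>e\<close> pays for lowering the values by
      \<open>d\<close>.\<close>
    define q where "q = d / (B * card Y)"
    have q: "q > 0" using d B N by (simp add: q_def)
    have pre: "s -` {y} \<in> sets M" for y
      using simple_functionD(2)[OF s(1), of "{y}"] P(3) by simp
    have "\<exists>K. compact K \<and> K \<subseteq> s -` {y} \<and> measure M (s -` {y} - K) < q" for y
      using M q pre P(2) unfolding radon_prob_def by blast
    then obtain K where K: "\<And>y. compact (K y)" "\<And>y. K y \<subseteq> s -` {y}" "\<And>y. measure M (s -` {y} - K y) < q"
      by metis
    have rest: "s -` {y} - K y \<in> sets M" for y
      using pre[of y] borel_compact[OF K(1)] P(2) by auto
    have ex: "\<exists>f\<in>Cb. (\<forall>z. 0 \<le> f z \<and> ennreal (f z) \<le> g z) \<and> (\<forall>y\<in>Y'. \<forall>z\<in>K y. enn2real y - d \<le> f z)"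
      if "finite Y'" "Y' \<subseteq> Y" for Y'
      using that
    proof (induction Y' rule: finite_induct)
      case empty
      show ?case by (intro bexI[of _ "\<lambda>_. 0"] Cb_const) auto
    next
      case (insert y Y')
      then obtain f where f: "f \<in> Cb" "\<And>z. 0 \<le> f z" "\<And>z. ennreal (f z) \<le> g z"
          "\<And>y z. y \<in> Y' \<Longrightarrow> z \<in> K y \<Longrightarrow> enn2real y - d \<le> f z"
        by auto
      show ?case
      \<comment> \<open>A value not exceeding \<open>d\<close> demands nothing of a nonnegative
        function; a larger one drops strictly when \<open>d\<close> is subtracted, which puts
        \<open>K y\<close> inside the open set \<open>U\<close>.\<close>
      proof (cases "enn2real y \<le> d")
        case True
        then have "enn2real y - d \<le> f z" for z using f(2)[of z] by linarith
        then show ?thesis using f by (intro bexI[of _ f]) auto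
      next
        case False
        define U where "U = {z. ennreal (enn2real y - d) < g z}"
        have "K y \<subseteq> U"
        proof
          fix z assume "z \<in> K y"
          then have "s z = y" using K(2) by auto
          then have "y \<le> g z" "y < top" using s(2) fin by (auto simp: le_fun_def)
          moreover have "ennreal (enn2real y - d) < ennreal (enn2real y)"
            using False d by (intro ennreal_lessI) auto
          ultimately show "z \<in> U" by (auto simp: U_def)
        qed
        then obtain h where h: "h \<in> unit_below U" "\<forall>z\<in>K y. h z = 1"
          using completely_regular_compact_separation[OF CR K(1) g[of "ennreal (enn2real y - d)"]]
          unfolding U_def by blast
        have h01: "0 \<le> h z" "h z \<le> 1" and h0: "z \<notin> U \<Longrightarrow> h z = 0" and hC: "h \<in> Cb" for z
          using h(1) by (auto simp: unit_below_def)
        define f' where "f' z = max (f z) ((enn2real y - d) * h z)" for z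
        have "ennreal ((enn2real y - d) * h z) \<le> g z" for z
        proof (cases "z \<in> U")
          case True
          have "ennreal ((enn2real y - d) * h z) \<le> ennreal (enn2real y - d)"
            using False h01[of z] by (intro ennreal_leI mult_left_le) auto
          also have "\<dots> \<le> g z" using True by (simp add: U_def)
          finally show ?thesis .
        qed (simp add: h0)
        then have "ennreal (f' z) \<le> g z" for z
          using f(3)[of z] by (simp add: f'_def max_def)
        moreover have "f' \<in> Cb" unfolding f'_def by (intro Cb_max f Cb_cmult hC)
        moreover have "0 \<le> f' z" for z using f(2) by (simp add: f'_def max.coboundedI1)
        moreover have "enn2real y' - d \<le> f' z" if "y' \<in> insert y Y'" "z \<in> K y'" for y' z
          using that f(4)[of y' z] h(2) by (auto simp: f'_def le_max_iff_disj)
        ultimately show ?thesis by (intro bexI[of _ f']) auto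
      qed
    qed
    obtain f where f: "f \<in> Cb" "\<And>z. 0 \<le> f z" "\<And>z. ennreal (f z) \<le> g z"
        "\<And>y z. y \<in> Y \<Longrightarrow> z \<in> K y \<Longrightarrow> enn2real y - d \<le> f z"
      using ex[OF Y subset_refl] by auto
    have fi: "integrable M f" by (rule Cb_integrable[OF P(1,2) f(1)])
    define E where "E = (\<Union>y\<in>Y. s -` {y} - K y)"
    have E: "E \<in> sets M" unfolding E_def using rest Y by auto
    have "measure M E \<le> (\<Sum>y\<in>Y. measure M (s -` {y} - K y))"
      unfolding E_def using rest Y by (intro measure_UNION_le) auto
    also have "\<dots> \<le> (\<Sum>y\<in>Y. q)" using K(3) by (intro sum_mono less_imp_le) auto
    finally have mE: "B * measure M E \<le> d" using B N by (simp add: q_def field_simps)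
    have pw: "s z \<le> ennreal (f z + d + B * indicator E z)" for z
    proof -
      have "enn2real (s z) \<le> f z + d + B * indicator E z"
      proof (cases "z \<in> K (s z)")
        case True
        have "0 \<le> B * indicator E z" using B by (simp add: indicator_def)
        then show ?thesis using f(4)[OF sY True] by simp
      next
        case False
        then have "z \<in> E" using sY by (auto simp: E_def)
        then show ?thesis using B(2)[OF sY, of z] f(2)[of z] d by simp
      qed
      then have "ennreal (enn2real (s z)) \<le> ennreal (f z + d + B * indicator E z)" by (rule ennreal_leI)
      then show ?thesis using fin by simp
    qed
    have iE: "integrable M (\<lambda>z. B * indicator E z)"
      using E by (simp add: emeasure_finite less_top[symmetric])
    have "integral\<^sup>S M s = (\<integral>\<^sup>+z. s z \<partial>M)" using s(1) by (rule nn_integral_eq_simple_integral[symmetric])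
    also have "\<dots> \<le> (\<integral>\<^sup>+z. ennreal (f z + d + B * indicator E z) \<partial>M)"
      by (intro nn_integral_mono pw)
    also have "\<dots> = ennreal (\<integral>z. f z + d + B * indicator E z \<partial>M)"
      using fi iE f(2) d B(1)
      by (intro nn_integral_eq_integral) (auto intro!: add_nonneg_nonneg less_imp_le[OF d])
    also have "(\<integral>z. f z + d + B * indicator E z \<partial>M) = (\<integral>z. f z \<partial>M) + d + B * measure M E"
      using fi iE E prob_space P(3) by simp
    also have "ennreal \<dots> \<le> ennreal ((\<integral>z. f z \<partial>M) + e)"
      using mE by (intro ennreal_leI) (simp add: d_def)
    also have "\<dots> = ennreal (\<integral>z. f z \<partial>M) + ennreal e"
      using e f(2) by (intro ennreal_plus) (auto intro!: integral_nonneg_AE)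
    also have "ennreal (\<integral>z. f z \<partial>M) \<le> ?S"
      using f by (intro SUP_upper) auto
    finally show "integral\<^sup>S M s \<le> ?S + ennreal e" by (simp add: add_right_mono)
  qed
qed

text \<open>The shift in \<open>kp_int\<close> is the true infimum: \<open>real_of_ereal\<close>
  would send an infinite one to 0, and the lower bound together with properness excludes
  that.\<close>

lemma lsc_bi_Inf:
  assumes "c \<in> lsc_bi"
  shows "ereal (real_of_ereal (Inf (range c))) = Inf (range c)"
proof -
  obtain b :: real where "\<And>x. ereal b \<le> c x" using assms by (auto simp: lsc_bi_def)
  then have "ereal b \<le> Inf (range c)" by (auto intro: INF_greatest)
  moreover obtain x where "c x \<noteq> \<infinity>" using assms by (auto simp: lsc_bi_def)
  then have "Inf (range c) < \<infinity>" by (metis INF_lower UNIV_I ereal_infty_less(1) order_le_less_trans)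
  ultimately show ?thesis by (intro ereal_real') auto
qed

text \<open>Subtracting the infimum \<open>b\<close> reduces to a nonnegative integrand. The
  passages \<open>h\<close> to \<open>b + h\<close> and \<open>f\<close> to
  \<open>max (f - b) 0\<close> translate between continuous functions below the shifted cost and
  below \<open>c\<close>. The right-hand side has the same form as \<open>op_int\<close>.\<close>

theorem kp_int_eq_Sup:
  fixes M :: "'a::t2_space measure"
  assumes CR: "completely_regular_space (euclidean :: 'a topology)"
    and M: "radon_prob M" and c: "c \<in> lsc_bi"
  shows "kp_int M c = Sup {ereal (\<integral>z. f z \<partial>M) | f. f \<in> Cb \<and> (\<forall>x. ereal (f x) \<le> c x)}"
    (is "_ = ?S")
proof -
  note P = radon_probD[OF M]
  interpret prob_space M by (rule P)
  define b where "b = real_of_ereal (Inf (range c))"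
  have b: "ereal b \<le> c x" for x
    unfolding b_def lsc_bi_Inf[OF c] by (rule INF_lower) simp
  define g where "g x = e2ennreal (c x - ereal b)" for x
  have kp: "kp_int M c = ereal b + enn2ereal (\<integral>\<^sup>+x. g x \<partial>M)"
    by (simp add: kp_int_def b_def g_def Let_def)
  have gc: "enn2ereal (g x) = c x - ereal b" for x
    unfolding g_def by (rule enn2ereal_e2ennreal) (use b[of x] in \<open>simp add: ereal_diff_positive\<close>)
  have cg: "c x = ereal b + enn2ereal (g x)" for x
    unfolding gc by (cases "c x") auto
  have "open {z. t < g z}" for t
  proof -
    have shift: "ereal b + x < ereal b + y \<longleftrightarrow> x < y" for x y
      by (cases x; cases y) auto
    have "ereal b + enn2ereal t < c z \<longleftrightarrow> t < g z" for z
      unfolding cg[of z] less_ennreal.rep_eq by (rule shift)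
    then have eq: "{z. t < g z} = - {z. c z \<le> ereal b + enn2ereal t}"
      unfolding Collect_neg_eq[symmetric] not_le by presburger
    have "closed {z. c z \<le> ereal b + enn2ereal t}" using c by (simp add: lsc_bi_def)
    then show ?thesis unfolding eq by (rule open_Compl)
  qed
  note lsc = radon_nn_integral_lsc[OF CR M this]
  show ?thesis
  proof (rule antisym)
    have below: "ereal (b + (\<integral>z. h z \<partial>M)) \<le> ?S"
      if h: "h \<in> Cb" "\<And>z. 0 \<le> h z" "\<And>z. ennreal (h z) \<le> g z" for h
    proof -
      have "ereal (b + h z) \<le> c z" for z
      proof -
        have "enn2ereal (ennreal (h z)) \<le> enn2ereal (g z)" using h(3)[of z] by (simp add: less_eq_ennreal.rep_eq)
        then have "ereal (h z) \<le> enn2ereal (g z)" using h(2)[of z] by (simp add: enn2ereal_ennreal)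
        then show ?thesis unfolding cg plus_ereal.simps(1)[symmetric] by (rule add_left_mono)
      qed
      moreover have "(\<lambda>z. b + h z) \<in> Cb" by (intro Cb_add Cb_const h)
      moreover have "(\<integral>z. b + h z \<partial>M) = b + (\<integral>z. h z \<partial>M)"
        using Cb_integrable[OF P(1,2) h(1)] prob_space by simp
      ultimately show ?thesis by (intro Sup_upper) force
    qed
    \<comment> \<open>Ensures that \<open>e2ennreal\<close> does not cut off a negative part of
      \<open>?S - ereal b\<close>.\<close>
    have S0: "ereal b \<le> ?S" using below[OF Cb_const[of 0]] by simp
    have "(\<integral>\<^sup>+x. g x \<partial>M) \<le> e2ennreal (?S - ereal b)"
    proof (rule order_trans[OF lsc], rule SUP_least, clarify)
      fix h :: "'a \<Rightarrow> real" assume h: "h \<in> Cb" "\<forall>z. 0 \<le> h z \<and> ennreal (h z) \<le> g z"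
      have "ereal (b + (\<integral>z. h z \<partial>M)) \<le> ?S" using h by (intro below) auto
      then have "ereal (\<integral>z. h z \<partial>M) \<le> ?S - ereal b"
        by (simp add: ereal_le_minus add.commute)
      then have "e2ennreal (ereal (\<integral>z. h z \<partial>M)) \<le> e2ennreal (?S - ereal b)" by (rule e2ennreal_mono)
      then show "ennreal (\<integral>z. h z \<partial>M) \<le> e2ennreal (?S - ereal b)" by (simp add: ennreal_def e2ennreal_def)
    qed
    then have "enn2ereal (\<integral>\<^sup>+x. g x \<partial>M) \<le> enn2ereal (e2ennreal (?S - ereal b))"
      by (simp add: less_eq_ennreal.rep_eq)
    also have "\<dots> = ?S - ereal b"
      by (rule enn2ereal_e2ennreal) (use S0 in \<open>simp add: ereal_diff_positive\<close>)
    finally have "ereal b + enn2ereal (\<integral>\<^sup>+x. g x \<partial>M) \<le> ereal b + (?S - ereal b)" by (rule add_left_mono)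
    also have "\<dots> = ?S" by (cases ?S) auto
    finally show "kp_int M c \<le> ?S" unfolding kp .
  next
    show "?S \<le> kp_int M c"
    proof (rule Sup_least, clarify)
      fix f :: "'a \<Rightarrow> real" assume f: "f \<in> Cb" "\<forall>x. ereal (f x) \<le> c x"
      \<comment> \<open>\<open>f\<close> may drop below \<open>b\<close>; the positive part of
        \<open>f - b\<close> still stays below the shifted cost because that cost is
        nonnegative.\<close>
      define h where "h z = max (f z - b) 0" for z
      have hC: "h \<in> Cb" unfolding h_def by (intro Cb_max Cb_diff Cb_const f)
      note hi = Cb_integrable[OF P(1,2) hC] and fi = Cb_integrable[OF P(1,2) f(1)]
      have "ennreal (h z) \<le> g z" for z
      proof -
        have "ereal (f z) - ereal b \<le> c z - ereal b" using f(2) by (intro ereal_minus_mono) auto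
        moreover have "0 \<le> c z - ereal b" using b[of z] by (simp add: ereal_diff_positive)
        ultimately have "ereal (h z) \<le> c z - ereal b" by (simp add: h_def max_def zero_ereal_def)
        moreover have "enn2ereal (ennreal (h z)) = ereal (h z)"
          by (rule enn2ereal_ennreal) (simp add: h_def)
        ultimately show ?thesis
          unfolding less_eq_ennreal.rep_eq gc by simp
      qed
      then have "(\<integral>\<^sup>+z. ennreal (h z) \<partial>M) \<le> (\<integral>\<^sup>+x. g x \<partial>M)" by (intro nn_integral_mono)
      moreover have "(\<integral>\<^sup>+z. ennreal (h z) \<partial>M) = ennreal (\<integral>z. h z \<partial>M)"
        by (rule nn_integral_eq_integral[OF hi]) (simp add: h_def)
      ultimately have "ennreal (\<integral>z. h z \<partial>M) \<le> (\<integral>\<^sup>+x. g x \<partial>M)" by simp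
      moreover have "0 \<le> (\<integral>z. h z \<partial>M)" by (rule integral_nonneg_AE) (simp add: h_def)
      ultimately have le: "ereal (\<integral>z. h z \<partial>M) \<le> enn2ereal (\<integral>\<^sup>+x. g x \<partial>M)"
        by (simp add: less_eq_ennreal.rep_eq enn2ereal_ennreal)
      have "(\<integral>z. f z \<partial>M) \<le> (\<integral>z. b + h z \<partial>M)"
        using hi fi by (intro integral_mono) (auto simp: h_def)
      also have "\<dots> = b + (\<integral>z. h z \<partial>M)" using hi prob_space by simp
      finally have "ereal (\<integral>z. f z \<partial>M) \<le> ereal b + ereal (\<integral>z. h z \<partial>M)" by simp
      also have "\<dots> \<le> ereal b + enn2ereal (\<integral>\<^sup>+x. g x \<partial>M)" using le by (rule add_left_mono)
      finally show "ereal (\<integral>z. f z \<partial>M) \<le> kp_int M c" unfolding kp .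
    qed
  qed
qed

lemma op_int_eq_kp_int:
  fixes M :: "'a::t2_space measure"
  assumes "completely_regular_space (euclidean :: 'a topology)" "radon_prob M" "c \<in> lsc_bi"
    and "\<And>f. f \<in> Cb \<Longrightarrow> fa_integral \<gamma> f = (\<integral>z. f z \<partial>M)"
  shows "op_int \<gamma> c = kp_int M c"
  unfolding kp_int_eq_Sup[OF assms(1-3)] op_int_def
  using assms(4) by (intro arg_cong[where f = Sup] Collect_cong) metis

section \<open>Existence of minimizers by compactness\<close>

lemma compact_PiE_UNIV:
  fixes S :: "'i \<Rightarrow> 'a::topological_space set"
  assumes "\<And>i. compact (S i)"
  shows "compact (PiE UNIV S)"
  using compactin_PiE[of "\<lambda>_. euclidean" UNIV S] assms
  by (simp add: euclidean_product_topology)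

text \<open>Tychonoff's theorem replaces metrizability: the integration functionals of a minimising sequence
  have a cluster point in a product of compact intervals, which need not be the limit of any
  subsequence.\<close>
lemma kp_minimizer_exists:
  fixes \<mu> :: "'a::t2_space measure" and \<nu> :: "'b::t2_space measure"
  assumes nX: "normal_space (euclidean :: 'a topology)" and nY: "normal_space (euclidean :: 'b topology)"
    and \<mu>: "radon_prob \<mu>" and \<nu>: "radon_prob \<nu>"
    and c: "c \<in> lsc_bi" and v: "vmin_KP \<mu> \<nu> c < \<infinity>"
  shows "\<exists>\<gamma>\<in>Pi_cpl \<mu> \<nu>. kp_int \<gamma> c = vmin_KP \<mu> \<nu> c"
proof -
  note CR = completely_regular_prod[OF nX nY]
  have Pi_radon: "radon_prob \<pi>" if "\<pi> \<in> Pi_cpl \<mu> \<nu>" for \<pi>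
    using that by (simp add: Pi_cpl_def)
  note kp = kp_int_eq_Sup[OF CR Pi_radon c]
  define w where "w = vmin_KP \<mu> \<nu> c"
  obtain b :: real where b: "\<And>z. ereal b \<le> c z" using c by (auto simp: lsc_bi_def)
  \<comment> \<open>Together with \<open>v\<close> this makes the infimum a real number
    \<open>r\<close>, so that \<open>r + 1 / (n + 1)\<close> lies strictly above it.\<close>
  have "ereal b \<le> w"
    unfolding w_def vmin_KP_def
  proof (rule INF_greatest)
    fix \<pi> assume \<pi>: "\<pi> \<in> Pi_cpl \<mu> \<nu>"
    interpret prob_space \<pi> by (rule radon_probD(1)[OF Pi_radon[OF \<pi>]])
    have "ereal b = ereal (\<integral>z. b \<partial>\<pi>)" using prob_space by simp
    also have "\<dots> \<le> kp_int \<pi> c"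
      unfolding kp[OF \<pi>] using b Cb_const[of b] by (intro Sup_upper) blast
    finally show "ereal b \<le> kp_int \<pi> c" .
  qed
  then obtain r where r: "w = ereal r" using v unfolding w_def[symmetric] by (cases w) auto
  have "\<exists>\<pi>\<in>Pi_cpl \<mu> \<nu>. kp_int \<pi> c < ereal (r + 1 / real (Suc n))" for n
  proof -
    have "w < ereal (r + 1 / real (Suc n))" by (simp add: r)
    then show ?thesis unfolding w_def vmin_KP_def by (simp add: INF_less_iff)
  qed
  then obtain p where p: "\<And>n. p n \<in> Pi_cpl \<mu> \<nu>" "\<And>n. kp_int (p n) c < ereal (r + 1 / real (Suc n))"
    by metis
  note P = radon_probD[OF Pi_radon[OF p(1)]]
  obtain B where B: "\<And>f :: 'a \<times> 'b \<Rightarrow> real. f \<in> Cb \<Longrightarrow> 0 < B f \<and> (\<forall>z. \<bar>f z\<bar> \<le> B f)"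
    using Cb_bound by metis
  \<comment> \<open>The product ranges over all real functions, so a value off \<open>Cb\<close> is
    needed; the default 0 matches the degenerate factor \<open>{0}\<close> of \<open>I\<close> and
    keeps every factor compact.\<close>
  define l where "l n = (\<lambda>f :: 'a \<times> 'b \<Rightarrow> real. if f \<in> Cb then (\<integral>z. f z \<partial>p n) else 0)" for n
  define I where "I f = (if f \<in> Cb then {- B f .. B f} else {0})" for f :: "'a \<times> 'b \<Rightarrow> real"
  have "compact (PiE UNIV I)"
    by (rule compact_PiE_UNIV) (simp add: I_def)
  moreover have lI: "l n \<in> PiE UNIV I" for n
  proof -
    have "\<bar>\<integral>z. f z \<partial>p n\<bar> \<le> B f" if f: "f \<in> Cb" for f
    proof -
      interpret prob_space "p n" by (rule P)
      have B': "f z \<le> B f" "- B f \<le> f z" for z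
        using B[OF f, THEN conjunct2, rule_format, of z] by linarith+
      have "(\<integral>z. f z \<partial>p n) \<le> (\<integral>z. B f \<partial>p n)" "(\<integral>z. - B f \<partial>p n) \<le> (\<integral>z. f z \<partial>p n)"
        using B' by (intro integral_mono Cb_integrable[OF P(1,2) f]; simp del: split_paired_All)+
      then show ?thesis using prob_space by simp
    qed
    then show ?thesis by (auto simp: l_def I_def abs_le_iff minus_le_iff)
  qed
  moreover have "filtermap l sequentially \<noteq> bot" by (simp add: filtermap_bot_iff)
  moreover have "eventually (\<lambda>L. L \<in> PiE UNIV I) (filtermap l sequentially)"
    using lI by (simp add: eventually_filtermap)
  ultimately obtain L where L: "inf (nhds L) (filtermap l sequentially) \<noteq> bot"
    unfolding compact_filter by blast
  \<comment> \<open>All properties of \<open>L\<close> are obtained through this fact: each is a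
    closed condition on finitely many coordinates that holds along the sequence, at least
    eventually.\<close>
  have clust: "L \<in> C" if C: "closed C" and ev: "eventually (\<lambda>n. l n \<in> C) sequentially" for C
  proof (rule ccontr)
    assume "L \<notin> C"
    then have "eventually (\<lambda>x. x \<in> - C) (nhds L)"
      using C by (intro eventually_nhds_in_open) auto
    moreover have "eventually (\<lambda>x. x \<in> C) (filtermap l sequentially)"
      using ev by (simp add: eventually_filtermap)
    ultimately have "eventually (\<lambda>_. False) (inf (nhds L) (filtermap l sequentially))"
      unfolding eventually_inf by blast
    then show False using L by (simp add: trivial_limit_def)
  qed
  have coord: "continuous_on UNIV (\<lambda>L :: ('a \<times> 'b \<Rightarrow> real) \<Rightarrow> real. L f)" for f
    by (rule continuous_on_product_coordinates)
  have lm: "l n f = (\<integral>z. f z \<partial>p n)" if "f \<in> Cb" for n f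
    using that by (simp add: l_def)
  note m = mean_functional_integral[OF P(1,2)]
  have Lmean: "mean_functional L"
    unfolding mean_functional_def
  proof (intro conjI ballI allI impI)
    fix f g :: "'a \<times> 'b \<Rightarrow> real" and a :: real assume f: "f \<in> Cb"
    have "L \<in> {L. L (\<lambda>z. a * f z) = a * L f}"
      using mean_cmult[OF m f]
      by (intro clust closed_Collect_eq continuous_intros coord) (simp add: lm f Cb_cmult)
    then show "L (\<lambda>z. a * f z) = a * L f" by simp
    { assume g: "g \<in> Cb"
      have "L \<in> {L. L (\<lambda>z. f z + g z) = L f + L g}"
        using mean_add[OF m f g]
        by (intro clust closed_Collect_eq continuous_intros coord) (simp add: lm f g Cb_add)
      then show "L (\<lambda>z. f z + g z) = L f + L g" by simp }
    { assume pos: "\<forall>z. 0 \<le> f z"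
      have "L \<in> {L. 0 \<le> L f}"
        using mean_nonneg[OF m f] pos
        by (intro clust closed_Collect_le continuous_intros coord) (simp add: lm f del: split_paired_All)
      then show "0 \<le> L f" by simp }
  next
    have "L \<in> {L. L (\<lambda>_. 1) = 1}"
      using mean_one[OF m]
      by (intro clust closed_Collect_eq continuous_intros coord) (simp add: lm Cb_const)
    then show "L (\<lambda>_. 1) = 1" by simp
  qed
  have marg: "L (\<lambda>(x, y). \<phi> x + \<psi> y) = (\<integral>x. \<phi> x \<partial>\<mu>) + (\<integral>y. \<psi> y \<partial>\<nu>)"
    if \<phi>: "\<phi> \<in> Cb" and \<psi>: "\<psi> \<in> Cb" for \<phi> \<psi>
  proof -
    have s: "(\<lambda>(x, y). \<phi> x + \<psi> y) \<in> Cb"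
      unfolding case_prod_unfold
      by (intro Cb_add Cb_compose[OF \<phi>] Cb_compose[OF \<psi>] continuous_intros)
    have "L \<in> {L. L (\<lambda>(x, y). \<phi> x + \<psi> y) = (\<integral>x. \<phi> x \<partial>\<mu>) + (\<integral>y. \<psi> y \<partial>\<nu>)}"
    proof (intro clust closed_Collect_eq continuous_on_const coord always_eventually allI CollectI)
      show "l n (\<lambda>(x, y). \<phi> x + \<psi> y) = (\<integral>x. \<phi> x \<partial>\<mu>) + (\<integral>y. \<psi> y \<partial>\<nu>)" for n
        unfolding lm[OF s] by (rule integral_Pi_cpl[OF p(1) \<phi> \<psi>])
    qed
    then show ?thesis by simp
  qed
  obtain \<pi> where \<pi>: "\<pi> \<in> Pi_cpl \<mu> \<nu>" "\<And>f. f \<in> Cb \<Longrightarrow> L f = (\<integral>z. f z \<partial>\<pi>)"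
    using mean_with_marginals_representation[OF nX nY \<mu> \<nu> Lmean marg] by blast
  have "kp_int \<pi> c \<le> w"
    unfolding kp[OF \<pi>(1)]
  proof (rule Sup_least, clarify)
    fix f :: "'a \<times> 'b \<Rightarrow> real" assume f: "f \<in> Cb" "\<forall>z. ereal (f z) \<le> c z"
    have ln: "l n f \<le> r + 1 / real (Suc n)" for n
    proof -
      have "ereal (\<integral>z. f z \<partial>p n) \<le> kp_int (p n) c"
        unfolding kp[OF p(1)] using f by (intro Sup_upper) blast
      also have "\<dots> < ereal (r + 1 / real (Suc n))" by (rule p)
      finally show ?thesis using f by (simp add: lm)
    qed
    \<comment> \<open>The bound on \<open>l n f\<close> varies with \<open>n\<close>, so it is first
      relaxed to one fixed closed half-line that contains a tail of the values.\<close>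
    have "L f \<le> r + e" if e: "e > 0" for e
    proof -
      obtain N where N: "1 / real (Suc N) < e"
        using reals_Archimedean[OF e] by (auto simp: inverse_eq_divide)
      have "L \<in> {L. L f \<le> r + e}"
      proof (intro clust closed_Collect_le continuous_on_const coord)
        show "eventually (\<lambda>n. l n \<in> {L. L f \<le> r + e}) sequentially"
          unfolding eventually_sequentially
        proof (intro exI[of _ N] allI impI CollectI)
          fix n assume "N \<le> n"
          then have "1 / real (Suc n) \<le> 1 / real (Suc N)" by (intro divide_left_mono) auto
          then show "l n f \<le> r + e" using ln[of n] N by linarith
        qed
      qed
      then show ?thesis by simp
    qed
    then have "L f \<le> r" by (rule field_le_epsilon)
    then show "ereal (\<integral>z. f z \<partial>\<pi>) \<le> w" using \<pi>(2)[OF f(1)] r by simp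
  qed
  moreover have "w \<le> kp_int \<pi> c" unfolding w_def vmin_KP_def by (rule INF_lower) (rule \<pi>)
  ultimately show ?thesis using \<pi>(1) unfolding w_def by (intro bexI[of _ \<pi>] antisym)
qed

theorem mainTheorem10:
  fixes \<mu> :: "'a::t2_space measure" and \<nu> :: "'b::t2_space measure"
  assumes "perfectly_normal (euclidean :: 'a topology)"
    and "perfectly_normal (euclidean :: 'b topology)"
    and "radon_prob \<mu>" and "radon_prob \<nu>"
  shows "(\<forall>\<gamma>\<in>Gamma \<mu> \<nu>. \<exists>\<pi>\<in>Pi_cpl \<mu> \<nu>. \<forall>f\<in>Cb. fa_integral \<gamma> f = (\<integral>z. f z \<partial>\<pi>))
       \<and> (\<forall>\<pi>\<in>Pi_cpl \<mu> \<nu>. (\<lambda>A. if A \<in> zero_algebra then measure \<pi> A else 0) \<in> Gamma \<mu> \<nu>)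
       \<and> (\<forall>c\<in>lsc_bi. vmin_OP \<mu> \<nu> c = vmin_KP \<mu> \<nu> c)
       \<and> (\<forall>c\<in>lsc_bi. vmin_KP \<mu> \<nu> c < \<infinity> \<longrightarrow>
            (\<exists>\<gamma>\<in>Pi_cpl \<mu> \<nu>. kp_int \<gamma> c = vmin_KP \<mu> \<nu> c))"
proof -
  have nX: "normal_space (euclidean :: 'a topology)" and nY: "normal_space (euclidean :: 'b topology)"
    using assms(1,2) by (auto simp: perfectly_normal_def)
  note CR = completely_regular_prod[OF nX nY]
  have represent: "\<exists>\<pi>\<in>Pi_cpl \<mu> \<nu>. \<forall>f\<in>Cb. fa_integral \<gamma> f = (\<integral>z. f z \<partial>\<pi>)" if "\<gamma> \<in> Gamma \<mu> \<nu>" for \<gamma>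
    using that
    by (intro mean_with_marginals_representation[OF nX nY assms(3,4)] mean_functional_fa_integral)
       (auto simp: Gamma_def)
  have restrict: "zero_restriction \<pi> \<in> Gamma \<mu> \<nu>" if "\<pi> \<in> Pi_cpl \<mu> \<nu>" for \<pi>
    using that by (rule zero_restriction_in_Gamma)
  \<comment> \<open>The infima range over different kinds of objects; each inequality turns a
    competitor of one problem into a competitor of the other with the same cost.\<close>
  have "vmin_OP \<mu> \<nu> c = vmin_KP \<mu> \<nu> c" if c: "c \<in> lsc_bi" for c
  proof (rule antisym)
    show "vmin_OP \<mu> \<nu> c \<le> vmin_KP \<mu> \<nu> c"
      unfolding vmin_KP_def
    proof (rule INF_greatest)
      fix \<pi> assume \<pi>: "\<pi> \<in> Pi_cpl \<mu> \<nu>"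
      then have r: "radon_prob \<pi>" by (simp add: Pi_cpl_def)
      have "op_int (zero_restriction \<pi>) c = kp_int \<pi> c"
        by (intro op_int_eq_kp_int CR r c fa_integral_zero_restriction radon_probD[OF r])
      then show "vmin_OP \<mu> \<nu> c \<le> kp_int \<pi> c"
        unfolding vmin_OP_def by (metis INF_lower restrict[OF \<pi>])
    qed
    show "vmin_KP \<mu> \<nu> c \<le> vmin_OP \<mu> \<nu> c"
      unfolding vmin_OP_def
    proof (rule INF_greatest)
      fix \<gamma> assume "\<gamma> \<in> Gamma \<mu> \<nu>"
      then obtain \<pi> where \<pi>: "\<pi> \<in> Pi_cpl \<mu> \<nu>" "\<And>f. f \<in> Cb \<Longrightarrow> fa_integral \<gamma> f = (\<integral>z. f z \<partial>\<pi>)"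
        using represent by blast
      then have "op_int \<gamma> c = kp_int \<pi> c"
        by (intro op_int_eq_kp_int CR c) (auto simp: Pi_cpl_def)
      then show "vmin_KP \<mu> \<nu> c \<le> op_int \<gamma> c"
        unfolding vmin_KP_def by (metis INF_lower \<pi>(1))
    qed
  qed
  then show ?thesis
    using represent restrict[unfolded zero_restriction_def]
      kp_minimizer_exists[OF nX nY assms(3,4)] by blast
qed

end
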